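(* There do not exist a monic polynomial $P\in\mathbb{Q}[X]$ of degree $4$ and a nonzero polynomial $Q\in\mathbb{Q}[X]$ of degree at most $3$ such that, with $T$ an indeterminate, the polynomial $P(X)-TQ(X)$ has Galois group $A_4$ both over $\mathbb{Q}(T)$ and over $\overline{\mathbb{Q}}(T)$.
   Context: $\overline{\mathbb{Q}}$ denotes an algebraic closure of $\mathbb{Q}$. The Galois group of a polynomial over a field $F$ is that of its splitting field over $F$, viewed as a permutation group on its roots. A line $P-TQ$ (with $P$ monic of degree $n$ and $Q\neq 0$ of degree at most $n-1$, coefficients in a number field $K$) having Galois group $A_n$ over both $K(T)$ and $\overline{\mathbb{Q}}(T)$ is called a strong alternating line over $K$; the theorem says there are no strong alternating lines of quartic polynomials over $\mathbb{Q}$. *)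

theory Defs
  imports
    "HOL-Algebra.Algebraic_Closure_Type"
    "HOL-Algebra.Generated_Fields"
    "HOL-Combinatorics.Permutations"
    "HOL-Computational_Algebra.Computational_Algebra"
begin

definition ac_roots :: "'a::field poly \<Rightarrow> 'a alg_closure set" where
  "ac_roots f = {x. poly (map_poly to_ac f) x = 0}"

text \<open>The splitting field of \<open>f\<close> inside the algebraic closure of its coefficient field: the
  subfield generated by the coefficient field and the roots of \<open>f\<close>.\<close>

definition splitting_field :: "'a::field poly \<Rightarrow> 'a alg_closure ring" where
  "splitting_field f =
     ring_of_type_algebra
       \<lparr>carrier := generate_field ring_of_type_algebra (range to_ac \<union> ac_roots f)\<rparr>"

definition splitting_field_automorphisms ::
  "'a::field poly \<Rightarrow> ('a alg_closure \<Rightarrow> 'a alg_closure) set" where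
  "splitting_field_automorphisms f =
     {\<sigma> \<in> ring_iso (splitting_field f) (splitting_field f). \<forall>c. \<sigma> (to_ac c) = to_ac c}"

text \<open>The Galois group viewed as a permutation group on the roots. As usual for \<open>permutes\<close>,
  a permutation of the roots is extended by the identity off the roots.\<close>

definition galois_group :: "'a::field poly \<Rightarrow> ('a alg_closure \<Rightarrow> 'a alg_closure) set" where
  "galois_group f = (\<lambda>\<sigma>. restrict_id \<sigma> (ac_roots f)) ` splitting_field_automorphisms f"

text \<open>The Galois group is \<open>A\<^sub>n\<close>: there are \<open>n\<close> distinct roots, and the group consists of all
  their even permutations.\<close>

definition has_alternating_galois_group :: "nat \<Rightarrow> 'a::field poly \<Rightarrow> bool" where
  "has_alternating_galois_group n f \<longleftrightarrow>
     card (ac_roots f) = n \<and> galois_group f = {\<pi>. \<pi> permutes ac_roots f \<and> evenperm \<pi>}"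

text \<open>\<open>P(X) - T Q(X)\<close> as a polynomial in \<open>X\<close> over the rational function field \<open>K(T)\<close>, which is
  the type \<open>'a poly fract\<close>; here \<open>[:0, 1:]\<close> is the indeterminate \<open>T\<close>.\<close>

definition poly_line :: "'a::field poly \<Rightarrow> 'a poly \<Rightarrow> 'a poly fract poly" where
  "poly_line P Q =
     map_poly (\<lambda>c. to_fract [:c:]) P - smult (to_fract [:0, 1:]) (map_poly (\<lambda>c. to_fract [:c:]) Q)"

end

theory Submission
  imports Defs
begin

text \<open>
  Write \<open>I\<close> and \<open>J\<close> for the invariants of binary quartics, so that \<open>4 I\<^sup>3 - J\<^sup>2\<close> is \<open>27\<close> times the
  discriminant. If the group over \<open>\<rat>(T)\<close> is \<open>A\<^sub>4\<close>, the discriminant of the line is a square, and after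
  a rational change of parameter \<open>27 D\<^sup>2 = 4 I\<^sup>3 - J\<^sup>2\<close> along a pencil \<open>u A - B\<close>, with a rational cubic \<open>D\<close>
  in \<open>u\<close>. A local computation shows that \<open>D\<close> has three distinct roots and that the quartic at such a
  root either is the square of a quadratic or has a triple root, the latter exactly when \<open>I\<close> vanishes.
  Two squares in the pencil would give a block system on the four roots, contradicting the geometric
  group \<open>A\<^sub>4\<close>. So \<open>I\<close>, which is of degree at most 2 in \<open>u\<close>, vanishes at two roots of \<open>D\<close>. It is not zero,
  because \<open>27 D\<^sup>2 = - J\<^sup>2\<close> is impossible over \<open>\<rat>\<close>. Hence \<open>I\<close> divides \<open>D\<close>, and as \<open>4 I\<^sup>3 = J\<^sup>2 + 27 D\<^sup>2\<close> is
  nonnegative its roots are complex conjugates, while the third root of \<open>D\<close> is rational. The apolar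
  pairing with \<open>(X - x)\<^sup>2 (X - y)\<^sup>2\<close>, where \<open>x\<close>, \<open>y\<close> are the two conjugate triple roots, vanishes on the pencil,
  but it is definite on squares of real quadratics.
\<close>

hide_const (open) Polynomials.degree Polynomials.lead_coeff

section \<open>Extending homomorphisms inside the algebraic closure\<close>

text \<open>Closure under inverses need not be assumed, since the algebraic closure is algebraic.\<close>

locale base_hom =
  fixes E :: "'a::field alg_closure set" and \<phi> :: "'a alg_closure \<Rightarrow> 'a alg_closure"
  assumes base_closed [simp, intro]: "to_ac c \<in> E"
    and add_closed [simp, intro]: "x \<in> E \<Longrightarrow> y \<in> E \<Longrightarrow> x + y \<in> E"
    and mult_closed [simp, intro]: "x \<in> E \<Longrightarrow> y \<in> E \<Longrightarrow> x * y \<in> E"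
    and hom_base [simp]: "\<phi> (to_ac c) = to_ac c"
    and hom_add [simp]: "x \<in> E \<Longrightarrow> y \<in> E \<Longrightarrow> \<phi> (x + y) = \<phi> x + \<phi> y"
    and hom_mult [simp]: "x \<in> E \<Longrightarrow> y \<in> E \<Longrightarrow> \<phi> (x * y) = \<phi> x * \<phi> y"
begin

lemma zero_closed [simp, intro]: "0 \<in> E"
  using base_closed[of 0] by simp

lemma one_closed [simp, intro]: "1 \<in> E"
  using base_closed[of 1] by simp

lemma hom_zero [simp]: "\<phi> 0 = 0"
  using hom_base[of 0] by simp

lemma hom_one [simp]: "\<phi> 1 = 1"
  using hom_base[of 1] by simp

lemma uminus_closed [simp, intro]: "x \<in> E \<Longrightarrow> - x \<in> E"
  using mult_closed[OF base_closed[of "-1"], of x] by simp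

lemma hom_uminus [simp]: "x \<in> E \<Longrightarrow> \<phi> (- x) = - \<phi> x"
  using hom_mult[OF base_closed[of "-1"], of x] hom_base[of "-1"] by simp

lemma diff_closed [simp, intro]: "x \<in> E \<Longrightarrow> y \<in> E \<Longrightarrow> x - y \<in> E"
  using add_closed[of x "- y"] by simp

lemma hom_diff [simp]: "x \<in> E \<Longrightarrow> y \<in> E \<Longrightarrow> \<phi> (x - y) = \<phi> x - \<phi> y"
  using hom_add[of x "- y"] by simp

lemma sum_closed [intro]: "(\<And>i. i \<in> I \<Longrightarrow> f i \<in> E) \<Longrightarrow> sum f I \<in> E"
  by (induction I rule: infinite_finite_induct) auto

lemma hom_sum: "(\<And>i. i \<in> I \<Longrightarrow> f i \<in> E) \<Longrightarrow> \<phi> (sum f I) = (\<Sum>i\<in>I. \<phi> (f i))"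
proof (induction I rule: infinite_finite_induct)
  case (insert i I)
  then show ?case
    using sum_closed[of I f] by (simp add: insert)
qed auto

definition coeffs_in :: "'a alg_closure poly \<Rightarrow> bool" where
  "coeffs_in p \<longleftrightarrow> (\<forall>i. coeff p i \<in> E)"

lemma coeffs_in_base [simp, intro]: "coeffs_in (map_poly to_ac p)"
  by (auto simp: coeffs_in_def coeff_map_poly)

lemma coeffs_in_0 [simp, intro]: "coeffs_in 0"
  by (auto simp: coeffs_in_def)

lemma coeffs_in_pCons [simp]: "coeffs_in (pCons c p) \<longleftrightarrow> c \<in> E \<and> coeffs_in p"
  by (auto simp: coeffs_in_def coeff_pCons all_conj_distrib split: nat.splits)

lemma coeffs_in_add [intro]: "coeffs_in p \<Longrightarrow> coeffs_in q \<Longrightarrow> coeffs_in (p + q)"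
  by (auto simp: coeffs_in_def)

lemma coeffs_in_diff [intro]: "coeffs_in p \<Longrightarrow> coeffs_in q \<Longrightarrow> coeffs_in (p - q)"
  by (auto simp: coeffs_in_def)

lemma coeffs_in_mult [intro]: "coeffs_in p \<Longrightarrow> coeffs_in q \<Longrightarrow> coeffs_in (p * q)"
  by (auto simp: coeffs_in_def coeff_mult intro!: sum_closed)

lemma coeffs_in_smult [intro]: "c \<in> E \<Longrightarrow> coeffs_in p \<Longrightarrow> coeffs_in (smult c p)"
  by (auto simp: coeffs_in_def)

lemma coeffs_in_monom [intro]: "c \<in> E \<Longrightarrow> coeffs_in (monom c n)"
  by (auto simp: coeffs_in_def)

lemma poly_closed: "coeffs_in p \<Longrightarrow> x \<in> E \<Longrightarrow> poly p x \<in> E"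
  by (induction p) auto

lemma coeff_map_hom [simp]: "coeff (map_poly \<phi> p) i = \<phi> (coeff p i)"
  by (simp add: coeff_map_poly)

lemma map_hom_base [simp]: "map_poly \<phi> (map_poly to_ac p) = map_poly to_ac p"
  by (rule poly_eqI) (simp add: coeff_map_poly)

lemma map_hom_add: "coeffs_in p \<Longrightarrow> coeffs_in q \<Longrightarrow> map_poly \<phi> (p + q) = map_poly \<phi> p + map_poly \<phi> q"
  by (rule poly_eqI) (auto simp: coeffs_in_def)

lemma map_hom_diff: "coeffs_in p \<Longrightarrow> coeffs_in q \<Longrightarrow> map_poly \<phi> (p - q) = map_poly \<phi> p - map_poly \<phi> q"
  by (rule poly_eqI) (auto simp: coeffs_in_def)

lemma map_hom_mult: "coeffs_in p \<Longrightarrow> coeffs_in q \<Longrightarrow> map_poly \<phi> (p * q) = map_poly \<phi> p * map_poly \<phi> q"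
  by (rule poly_eqI) (auto simp: coeffs_in_def coeff_mult hom_sum)

lemma map_hom_smult: "c \<in> E \<Longrightarrow> coeffs_in p \<Longrightarrow> map_poly \<phi> (smult c p) = smult (\<phi> c) (map_poly \<phi> p)"
  by (rule poly_eqI) (auto simp: coeffs_in_def)

lemma map_hom_monom: "map_poly \<phi> (monom c n) = monom (\<phi> c) n"
  by (rule poly_eqI) auto

lemma hom_poly: "coeffs_in p \<Longrightarrow> x \<in> E \<Longrightarrow> \<phi> (poly p x) = poly (map_poly \<phi> p) (\<phi> x)"
  by (induction p) (auto simp: map_poly_pCons poly_closed)

lemma hom_poly_base: "x \<in> E \<Longrightarrow> \<phi> (poly (map_poly to_ac p) x) = poly (map_poly to_ac p) (\<phi> x)"
  by (simp add: hom_poly)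

text \<open>Stripping factors of the variable from an annihilating polynomial leaves a nonzero
  constant term \<open>c\<close>. The relation \<open>to_ac c + x * y = 0\<close>, with
  \<open>y\<close> a polynomial value at \<open>x\<close>, then exhibits the inverse.\<close>

lemma inverse_closed [intro]:
  assumes "x \<in> E"
  shows "inverse x \<in> E"
proof (cases "x = 0")
  case False
  have "inverse x \<in> E" if "p \<noteq> 0" "poly (map_poly to_ac p) x = 0" for p
    using that
  proof (induction p)
    case (pCons c p)
    have eq: "to_ac c + x * poly (map_poly to_ac p) x = 0"
      using pCons.prems by (simp add: map_poly_pCons)
    show ?case
    proof (cases "c = 0")
      case True
      then show ?thesis
        using pCons eq False by auto
    next
      case False
      have "inverse x = to_ac (inverse (- c)) * poly (map_poly to_ac p) x"
      proof (rule inverse_unique)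
        have "to_ac (inverse (- c)) * to_ac (- c) = 1"
          using False by (simp flip: to_ac_mult)
        then show "x * (to_ac (inverse (- c)) * poly (map_poly to_ac p) x) = 1"
          using eq by (metis add_eq_0_iff mult.left_commute to_ac_minus minus_equation_iff)
      qed
      then show ?thesis
        using assms by (metis base_closed mult_closed coeffs_in_base poly_closed)
    qed
  qed auto
  then show ?thesis
    using alg_closure_algebraic[of x] by metis
qed auto

lemma hom_nonzero:
  assumes "x \<in> E" "x \<noteq> 0"
  shows "\<phi> x \<noteq> 0"
proof
  assume "\<phi> x = 0"
  then have "\<phi> (x * inverse x) = 0"
    using assms inverse_closed[of x] by (subst hom_mult) auto
  then show False
    using assms by simp
qed

lemma hom_inj: "inj_on \<phi> E"
proof (rule inj_onI)
  fix x y assume "x \<in> E" "y \<in> E" "\<phi> x = \<phi> y"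
  then show "x = y"
    using hom_nonzero[of "x - y"] by auto
qed

text \<open>The new domain is E[a], already a field because everything is algebraic. The hypothesis
  amounts to saying that the image of \<open>poly h a\<close> does not depend on the choice of
  \<open>h\<close>.\<close>

lemma extend_with_image:
  assumes ab: "\<And>h. coeffs_in h \<Longrightarrow> poly h a = 0 \<Longrightarrow> poly (map_poly \<phi> h) b = 0"
  obtains E' \<psi> where "base_hom E' \<psi>" "E \<subseteq> E'" "a \<in> E'" "\<And>x. x \<in> E \<Longrightarrow> \<psi> x = \<phi> x" "\<psi> a = b"
proof -
  define E' where "E' = {poly h a |h. coeffs_in h}"
  define \<psi> where "\<psi> y = poly (map_poly \<phi> (SOME h. coeffs_in h \<and> poly h a = y)) b" for y
  have \<psi>: "\<psi> (poly h a) = poly (map_poly \<phi> h) b" if h: "coeffs_in h" for h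
  proof -
    define g where "g = (SOME g. coeffs_in g \<and> poly g a = poly h a)"
    have g: "coeffs_in g" "poly g a = poly h a"
      unfolding g_def using someI[of "\<lambda>g. coeffs_in g \<and> poly g a = poly h a" h] h by auto
    then have "poly (map_poly \<phi> (g - h)) b = 0"
      using h by (intro ab) auto
    then show ?thesis
      using g h by (simp add: map_hom_diff \<psi>_def g_def)
  qed
  show thesis
  proof (rule that)
    have const: "c \<in> E'" "\<psi> c = \<phi> c" if "c \<in> E" for c
      using that \<psi>[of "[:c:]"] by (auto simp: E'_def map_poly_pCons intro!: exI[of _ "[:c:]"])
    show "base_hom E' \<psi>"
    proof
      show "to_ac c \<in> E'" "\<psi> (to_ac c) = to_ac c" for c
        using const[of "to_ac c"] by auto
      fix x y assume "x \<in> E'" "y \<in> E'"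
      then obtain g h where gh: "coeffs_in g" "x = poly g a" "coeffs_in h" "y = poly h a"
        by (auto simp: E'_def)
      show "x + y \<in> E'" "x * y \<in> E'"
        using gh by (auto simp: E'_def intro: exI[of _ "g + h"] exI[of _ "g * h"])
      show "\<psi> (x + y) = \<psi> x + \<psi> y"
        using gh \<psi>[of "g + h"] by (auto simp: map_hom_add \<psi>)
      show "\<psi> (x * y) = \<psi> x * \<psi> y"
        using gh \<psi>[of "g * h"] by (auto simp: map_hom_mult \<psi>)
    qed
    show "E \<subseteq> E'"
      using const by auto
    show "\<psi> x = \<phi> x" if "x \<in> E" for x
      using const that by auto
    show "a \<in> E'" "\<psi> a = b"
      using \<psi>[of "[:0, 1:]"]
      by (auto simp: E'_def map_poly_pCons intro!: exI[of _ "[:0, 1:]"])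
  qed
qed

text \<open>The image of \<open>a\<close> is a root of the image of a minimal polynomial \<open>m\<close>. Cancelling leading
  terms against \<open>m\<close> shows by descent that every relation satisfied by \<open>a\<close> is preserved.\<close>

lemma extend:
  obtains E' \<psi> where "base_hom E' \<psi>" "E \<subseteq> E'" "a \<in> E'" "\<And>x. x \<in> E \<Longrightarrow> \<psi> x = \<phi> x"
proof -
  define P where "P m \<longleftrightarrow> coeffs_in m \<and> m \<noteq> 0 \<and> poly m a = 0" for m
  have "\<exists>m. P m"
    using alg_closure_algebraic[of a] by (metis P_def map_poly_eq_0_iff coeffs_in_base to_ac_0 to_ac_eq_0_iff)
  then obtain m where m: "P m" and min: "\<And>h. P h \<Longrightarrow> degree m \<le> degree h"
    using arg_min_natI[of P _ degree] arg_min_nat_le[of P _ degree] by metis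
  have lc: "\<phi> (lead_coeff m) \<noteq> 0"
    using m by (intro hom_nonzero) (auto simp: P_def coeffs_in_def)
  have "degree m > 0"
  proof (rule ccontr)
    assume "\<not> degree m > 0"
    then obtain c where "m = [:c:]"
      by (metis degree_eq_zeroE neq0_conv)
    then show False
      using m by (auto simp: P_def)
  qed
  then have "degree (map_poly \<phi> m) > 0"
    using lc by (metis coeff_map_hom le_degree less_le_trans)
  then obtain b where b: "poly (map_poly \<phi> m) b = 0"
    using alg_closed_imp_poly_has_root by blast
  have "poly (map_poly \<phi> h) b = 0" if "coeffs_in h" "poly h a = 0" for h
    using that
  proof (induction "degree h" arbitrary: h rule: less_induct)
    case (less h)
    show ?case
    proof (cases "h = 0")
      case False
      then have le: "degree m \<le> degree h"
        using less.prems by (intro min) (auto simp: P_def)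
      define k where "k = degree h - degree m"
      define s where "s = monom (lead_coeff h) k * m"
      \<comment> \<open>Scaling \<open>h\<close> by the leading coefficient of \<open>m\<close>
        avoids a division; \<open>lc\<close> allows its image to be cancelled at the end.\<close>
      define g where "g = smult (lead_coeff m) h - s"
      have in_E: "lead_coeff m \<in> E" "lead_coeff h \<in> E" "coeffs_in m" "coeffs_in h"
        using m less.prems by (auto simp: P_def coeffs_in_def)
      then have ov: "coeffs_in (monom (lead_coeff h) k)" "coeffs_in s" "coeffs_in (smult (lead_coeff m) h)" "coeffs_in g"
        unfolding g_def s_def by (intro coeffs_in_diff coeffs_in_smult coeffs_in_mult coeffs_in_monom; simp)+
      have deg_s: "degree s = degree h"
        using False m le by (auto simp: s_def degree_mult_eq degree_monom_eq P_def k_def monom_eq_0_iff)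
      have lc_s: "lead_coeff s = lead_coeff h * lead_coeff m"
        using False m by (auto simp: s_def lead_coeff_mult degree_monom_eq P_def)
      have "poly (map_poly \<phi> g) b = 0"
      proof (cases "degree h = 0")
        case True
        then show ?thesis
          using \<open>degree m > 0\<close> le by simp
      next
        case nz: False
        have "degree g < degree h"
        proof (rule degree_lessI)
          show "g \<noteq> 0 \<or> degree h > 0"
            using nz by auto
          show "\<forall>i\<ge>degree h. coeff g i = 0"
          proof (intro allI impI)
            fix i assume "i \<ge> degree h"
            then show "coeff g i = 0"
              using deg_s lc_s by (cases "i = degree h") (auto simp: g_def coeff_eq_0)
          qed
        qed
        then show ?thesis
          using ov m less.prems by (intro less.hyps) (auto simp: g_def s_def P_def)
      qed
      then have "\<phi> (lead_coeff m) * poly (map_poly \<phi> h) b = 0"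
        using ov in_E b
        by (simp add: g_def s_def map_hom_diff map_hom_smult map_hom_mult map_hom_monom)
      then show ?thesis
        using lc by simp
    qed auto
  qed
  then show thesis
    using extend_with_image[of a b] that by metis
qed

lemma extend_finite:
  assumes "finite R"
  shows "\<exists>E' \<psi>. base_hom E' \<psi> \<and> E \<subseteq> E' \<and> R \<subseteq> E' \<and> (\<forall>x\<in>E. \<psi> x = \<phi> x)"
  using assms
proof (induction R)
  case empty
  then show ?case
    using base_hom_axioms by blast
next
  case (insert a R)
  then obtain E1 \<psi>1 where 1: "base_hom E1 \<psi>1" "E \<subseteq> E1" "R \<subseteq> E1" "\<forall>x\<in>E. \<psi>1 x = \<phi> x"
    by blast
  then interpret e: base_hom E1 \<psi>1
    by simp
  obtain E' \<psi> where "base_hom E' \<psi>" "E1 \<subseteq> E'" "a \<in> E'" "\<And>x. x \<in> E1 \<Longrightarrow> \<psi> x = \<psi>1 x"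
    using e.extend[of a] by metis
  then show ?case
    using 1 by (intro exI[of _ E'] exI[of _ \<psi>]) auto
qed

end

section \<open>Automorphisms of splitting fields\<close>

lemma ring_of_type_algebra_ops:
  fixes x y :: "'a::field"
  shows "\<one>\<^bsub>ring_of_type_algebra\<^esub> = (1::'a)" "\<zero>\<^bsub>ring_of_type_algebra\<^esub> = (0::'a)"
    "x \<oplus>\<^bsub>ring_of_type_algebra\<^esub> y = x + y" "x \<otimes>\<^bsub>ring_of_type_algebra\<^esub> y = x * y"
    "\<ominus>\<^bsub>ring_of_type_algebra\<^esub> x = - x" "x \<noteq> 0 \<Longrightarrow> inv\<^bsub>ring_of_type_algebra\<^esub> x = inverse x"
proof -
  interpret R: field "ring_of_type_algebra :: 'a ring"
    by (rule field_from_type_algebra)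
  show ops: "\<one>\<^bsub>ring_of_type_algebra\<^esub> = (1::'a)" "\<zero>\<^bsub>ring_of_type_algebra\<^esub> = (0::'a)"
    "x \<oplus>\<^bsub>ring_of_type_algebra\<^esub> y = x + y" "x \<otimes>\<^bsub>ring_of_type_algebra\<^esub> y = x * y" for x y :: 'a
    by (auto simp: ring_of_type_algebra_def)
  have UNIV: "carrier ring_of_type_algebra = (UNIV :: 'a set)"
    by (auto simp: ring_of_type_algebra_def)
  show "\<ominus>\<^bsub>ring_of_type_algebra\<^esub> x = - x"
    by (rule R.minus_equality) (auto simp: ops UNIV)
  show "inv\<^bsub>ring_of_type_algebra\<^esub> x = inverse x" if "x \<noteq> 0"
    using that by (intro R.inv_unique'[symmetric]) (auto simp: ops UNIV)
qed

lemma generate_field_closed: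
  fixes x y :: "'a::field" and H :: "'a set"
  defines "G \<equiv> generate_field ring_of_type_algebra H"
  shows "1 \<in> G" "x \<in> G \<Longrightarrow> - x \<in> G" "x \<in> G \<Longrightarrow> x \<noteq> 0 \<Longrightarrow> inverse x \<in> G"
    "x \<in> G \<Longrightarrow> y \<in> G \<Longrightarrow> x + y \<in> G" "x \<in> G \<Longrightarrow> y \<in> G \<Longrightarrow> x * y \<in> G"
  using generate_field.one[of ring_of_type_algebra H] generate_field.a_inv[of x ring_of_type_algebra H]
    generate_field.m_inv[of x ring_of_type_algebra H]
    generate_field.eng_add[of x ring_of_type_algebra H y]
    generate_field.eng_mult[of x ring_of_type_algebra H y]
  by (simp_all add: G_def ring_of_type_algebra_ops)

lemma splitting_field_sel [simp]:
  "carrier (splitting_field f) = generate_field ring_of_type_algebra (range to_ac \<union> ac_roots f)"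
  "\<one>\<^bsub>splitting_field f\<^esub> = 1" "x \<oplus>\<^bsub>splitting_field f\<^esub> y = x + y" "x \<otimes>\<^bsub>splitting_field f\<^esub> y = x * y"
  by (auto simp: splitting_field_def ring_of_type_algebra_ops)

lemma root_in_splitting_field: "x \<in> ac_roots f \<Longrightarrow> x \<in> carrier (splitting_field f)"
  by (simp add: generate_field.incl)

lemma automorphism_base_hom:
  assumes "\<sigma> \<in> splitting_field_automorphisms f"
  shows "base_hom (carrier (splitting_field f)) \<sigma>"
proof -
  let ?L = "carrier (splitting_field f)"
  have \<sigma>: "\<sigma> \<in> ring_hom (splitting_field f) (splitting_field f)" "\<And>c. \<sigma> (to_ac c) = to_ac c"
    using assms by (auto simp: splitting_field_automorphisms_def ring_iso_def)
  show ?thesis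
  proof
    show "to_ac c \<in> ?L" "\<sigma> (to_ac c) = to_ac c" for c
      using \<sigma> by (auto intro: generate_field.incl)
    fix x y assume xy: "x \<in> ?L" "y \<in> ?L"
    show "x + y \<in> ?L" "x * y \<in> ?L"
      using xy by (auto intro: generate_field_closed)
    show "\<sigma> (x + y) = \<sigma> x + \<sigma> y" "\<sigma> (x * y) = \<sigma> x * \<sigma> y"
      using ring_hom_add[OF \<sigma>(1) xy] ring_hom_mult[OF \<sigma>(1) xy] by auto
  qed
qed

lemma (in base_hom) splitting_field_subset:
  assumes "ac_roots f \<subseteq> E"
  shows "carrier (splitting_field f) \<subseteq> E"
proof
  fix x assume "x \<in> carrier (splitting_field f)"
  then have "x \<in> generate_field ring_of_type_algebra (range to_ac \<union> ac_roots f)"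
    by simp
  then show "x \<in> E"
    by induction (use assms in \<open>auto simp: ring_of_type_algebra_ops\<close>)
qed

lemma finite_ac_roots: "f \<noteq> 0 \<Longrightarrow> finite (ac_roots f)"
  unfolding ac_roots_def by (rule poly_roots_finite) (simp add: map_poly_eq_0_iff)

lemma (in base_hom) bij_roots:
  assumes "ac_roots f \<subseteq> E" "f \<noteq> 0"
  shows "bij_betw \<phi> (ac_roots f) (ac_roots f)"
proof -
  have sub: "\<phi> ` ac_roots f \<subseteq> ac_roots f"
  proof safe
    fix x assume x: "x \<in> ac_roots f"
    then have "poly (map_poly to_ac f) (\<phi> x) = \<phi> 0"
      using assms by (subst hom_poly_base[symmetric]) (auto simp: ac_roots_def)
    then show "\<phi> x \<in> ac_roots f"
      by (simp add: ac_roots_def)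
  qed
  moreover have "inj_on \<phi> (ac_roots f)"
    using hom_inj assms(1) inj_on_subset by blast
  ultimately show ?thesis
    using finite_ac_roots[OF assms(2)] by (simp add: bij_betw_def endo_inj_surj)
qed

text \<open>\<open>\<phi>\<close> permutes the finite set of roots and fixes the base, so stability
  and surjectivity on the splitting field both follow by induction on its generation. Injectivity
  holds for every homomorphism of fields.\<close>

lemma (in base_hom) in_automorphisms:
  assumes roots: "ac_roots f \<subseteq> E" and "f \<noteq> 0"
  shows "\<phi> \<in> splitting_field_automorphisms f"
proof -
  let ?L = "carrier (splitting_field f)"
  let ?G = "generate_field ring_of_type_algebra (range to_ac \<union> ac_roots f)"
  have sub: "?L \<subseteq> E"
    using splitting_field_subset[OF roots] .
  have perm: "\<phi> ` ac_roots f = ac_roots f"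
    using bij_roots[OF roots \<open>f \<noteq> 0\<close>] by (simp add: bij_betw_def)
  have inv: "\<phi> (inverse x) = inverse (\<phi> x)" if "x \<in> E" for x
  proof (cases "x = 0")
    case False
    then have "\<phi> x * \<phi> (inverse x) = 1"
      using that inverse_closed[OF that] by (subst hom_mult[symmetric]) auto
    then show ?thesis
      by (rule inverse_unique[symmetric])
  qed auto
  have sub': "x \<in> E" if "x \<in> ?G" for x
    using sub that by auto
  have into: "\<phi> x \<in> ?G" if "x \<in> ?G" for x
    using that
  proof induction
    case (incl h)
    then show ?case
      using perm by (auto intro: generate_field.incl)
  next
    case (m_inv h)
    then show ?case
      using hom_nonzero[of h] generate_field_closed(3)
      by (simp add: ring_of_type_algebra_ops inv sub')
  qed (simp_all add: ring_of_type_algebra_ops sub' generate_field_closed)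
  have onto: "x \<in> \<phi> ` ?G" if "x \<in> ?G" for x
    using that
  proof induction
    case one
    show ?case
      by (rule image_eqI[of _ _ 1]) (simp_all add: ring_of_type_algebra_ops generate_field_closed)
  next
    case (incl h)
    then consider c where "h = to_ac c" | "h \<in> \<phi> ` ac_roots f"
      using perm by auto
    then show ?case
    proof cases
      case 1
      then show ?thesis
        by (intro image_eqI[of _ _ h]) (auto intro: generate_field.incl)
    next
      case 2
      then show ?thesis
        by (auto intro: generate_field.incl)
    qed
  next
    case (a_inv h)
    then obtain y where "y \<in> ?G" "h = \<phi> y"
      by blast
    then show ?case
      by (intro image_eqI[of _ _ "- y"])
        (simp_all add: ring_of_type_algebra_ops sub' generate_field_closed)
  next
    case (m_inv h)
    then obtain y where "y \<in> ?G" "h = \<phi> y"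
      by blast
    moreover have "y \<noteq> 0"
      using calculation m_inv.hyps by (auto simp: ring_of_type_algebra_ops)
    ultimately show ?case
      using m_inv.hyps by (intro image_eqI[of _ _ "inverse y"])
        (simp_all add: ring_of_type_algebra_ops sub' inv generate_field_closed)
  next
    case (eng_add h1 h2)
    then obtain y z where "y \<in> ?G" "h1 = \<phi> y" "z \<in> ?G" "h2 = \<phi> z"
      by blast
    then show ?case
      by (intro image_eqI[of _ _ "y + z"])
        (simp_all add: ring_of_type_algebra_ops sub' generate_field_closed)
  next
    case (eng_mult h1 h2)
    then obtain y z where "y \<in> ?G" "h1 = \<phi> y" "z \<in> ?G" "h2 = \<phi> z"
      by blast
    then show ?case
      by (intro image_eqI[of _ _ "y * z"])
        (simp_all add: ring_of_type_algebra_ops sub' generate_field_closed)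
  qed
  have "\<phi> \<in> ring_hom (splitting_field f) (splitting_field f)"
    using into sub' by (simp add: ring_hom_def)
  moreover have "bij_betw \<phi> ?L ?L"
    using into onto inj_on_subset[OF hom_inj sub] unfolding bij_betw_def splitting_field_sel by blast
  ultimately show ?thesis
    by (auto simp: splitting_field_automorphisms_def ring_iso_def)
qed

section \<open>Alternating Galois groups of degree four\<close>

definition vandermonde4 :: "'a::comm_ring_1 \<Rightarrow> 'a \<Rightarrow> 'a \<Rightarrow> 'a \<Rightarrow> 'a" where
  "vandermonde4 a b c d = (a - b) * (a - c) * (a - d) * (b - c) * (b - d) * (c - d)"

lemma vandermonde4_transpose:
  assumes "distinct [r1, r2, r3, r4]" "x \<in> {r1, r2, r3, r4}" "y \<in> {r1, r2, r3, r4}" "x \<noteq> y"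
  shows "vandermonde4 (g (transpose x y r1)) (g (transpose x y r2)) (g (transpose x y r3))
      (g (transpose x y r4)) = - vandermonde4 (g r1) (g r2) (g r3) (g r4)"
  using assms by (auto simp: vandermonde4_def transpose_def) (simp_all add: algebra_simps)

text \<open>Induction on a product of transpositions: the arbitrary \<open>g\<close> absorbs the
  transposition applied last, which reverses the sign.\<close>

lemma vandermonde4_permute:
  assumes "\<pi> permutes {r1, r2, r3, r4}" "distinct [r1, r2, r3, r4]"
  shows "vandermonde4 (g (\<pi> r1)) (g (\<pi> r2)) (g (\<pi> r3)) (g (\<pi> r4)) =
    of_int (sign \<pi>) * vandermonde4 (g r1) (g r2) (g r3) (g r4)"
proof -
  have "finite {r1, r2, r3, r4}"
    by simp
  with assms(1) show ?thesis
  proof (induction arbitrary: g rule: permutes_induct)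
    case id
    then show ?case
      by simp
  next
    case (swap a b p)
    have "permutation p"
      using swap by (meson finite.emptyI finite_insert permutation_permutes)
    then have "sign (transpose a b \<circ> p) = - sign p"
      using swap by (simp add: sign_compose permutation_swap_id sign_swap_id)
    then show ?case
      using swap.IH[of "g \<circ> transpose a b"] vandermonde4_transpose[OF assms(2) swap.hyps(1-3), of g]
      by (simp add: o_def)
  qed
qed

lemma alternating_automorphism_even:
  assumes "has_alternating_galois_group n f" "\<sigma> \<in> splitting_field_automorphisms f"
  shows "restrict_id \<sigma> (ac_roots f) permutes ac_roots f" "evenperm (restrict_id \<sigma> (ac_roots f))"
  using assms by (auto simp: has_alternating_galois_group_def galois_group_def)

lemma alternating_three_cycle:
  assumes "has_alternating_galois_group 4 f" "ac_roots f = {r1, r2, r3, r4}"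
    and "distinct [r1, r2, r3, r4]"
  obtains \<sigma> where "\<sigma> \<in> splitting_field_automorphisms f"
    "\<sigma> r1 = r2" "\<sigma> r2 = r3" "\<sigma> r3 = r1" "\<sigma> r4 = r4"
proof -
  define \<pi> where "\<pi> = transpose r1 r2 \<circ> transpose r2 r3"
  have "\<pi> permutes ac_roots f"
    unfolding \<pi>_def assms(2) by (intro permutes_compose permutes_swap_id) auto
  moreover have "evenperm \<pi>"
    using assms(3) by (simp add: \<pi>_def evenperm_comp permutation_swap_id evenperm_swap)
  ultimately have "\<pi> \<in> galois_group f"
    using assms(1) by (simp add: has_alternating_galois_group_def)
  then obtain \<sigma> where \<sigma>: "\<sigma> \<in> splitting_field_automorphisms f" "\<pi> = restrict_id \<sigma> (ac_roots f)"
    by (auto simp: galois_group_def)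
  have "\<sigma> x = \<pi> x" if "x \<in> ac_roots f" for x
    using \<sigma>(2) that by (simp add: restrict_id_def)
  then have "\<sigma> r1 = r2" "\<sigma> r2 = r3" "\<sigma> r3 = r1" "\<sigma> r4 = r4"
    using assms(2,3) by (auto simp: \<pi>_def transpose_def)
  with \<sigma>(1) show thesis
    by (rule that)
qed

text \<open>If \<open>\<delta> \<notin> K\<close> then \<open>\<delta> \<mapsto> - \<delta>\<close> is a homomorphism over \<open>K\<close>, and its extension to the splitting
  field is an odd permutation of the roots.\<close>

lemma vandermonde_in_base:
  fixes f :: "'a::field_char_0 poly"
  assumes alt: "has_alternating_galois_group 4 f" and "f \<noteq> 0"
    and roots: "ac_roots f = {r1, r2, r3, r4}" and dist: "distinct [r1, r2, r3, r4]"
    and sq: "vandermonde4 r1 r2 r3 r4 ^ 2 = to_ac D"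
  shows "vandermonde4 r1 r2 r3 r4 \<in> range to_ac"
proof (rule ccontr)
  define \<delta> where "\<delta> = vandermonde4 r1 r2 r3 r4"
  assume "vandermonde4 r1 r2 r3 r4 \<notin> range to_ac"
  then have \<delta>: "\<delta> \<notin> range to_ac"
    by (simp add: \<delta>_def)
  interpret base_hom "range (to_ac :: 'a \<Rightarrow> _)" id
    by standard (auto simp flip: to_ac_add to_ac_mult)
  have "poly (map_poly id h) (- \<delta>) = 0" if h: "coeffs_in h" "poly h \<delta> = 0" for h
  proof -
    \<comment> \<open>Reduction modulo \<open>s ^ 2 = to_ac D\<close> leaves a linear remainder
      whose coefficients in the base field serve both square roots, \<delta> and
      \<open>- \<delta>\<close>.\<close>
    have "\<exists>e u. \<forall>s. s ^ 2 = to_ac D \<longrightarrow> poly h s = to_ac e + to_ac u * s"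
      using h(1)
    proof (induction h)
      case 0
      show ?case
        by (intro exI[of _ 0]) auto
    next
      case (pCons c h)
      then obtain e u c' where
        "\<forall>s. s ^ 2 = to_ac D \<longrightarrow> poly h s = to_ac e + to_ac u * s" "c = to_ac c'"
        by auto
      then have "\<forall>s. s ^ 2 = to_ac D \<longrightarrow> poly (pCons c h) s = to_ac (c' + u * D) + to_ac e * s"
        by (auto simp: algebra_simps power2_eq_square)
      then show ?case
        by blast
    qed
    then obtain e u where eu: "\<And>s. s ^ 2 = to_ac D \<Longrightarrow> poly h s = to_ac e + to_ac u * s"
      by blast
    have \<delta>_eq: "to_ac e + to_ac u * \<delta> = 0"
      using eu[of \<delta>] h(2) sq by (simp add: \<delta>_def)
    have "u = 0"
    proof (rule ccontr)
      assume "u \<noteq> 0"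
      then have "\<delta> = to_ac (- e / u)"
        using \<delta>_eq by (simp add: field_simps add_eq_0_iff)
      then show False
        using \<delta> by blast
    qed
    then show ?thesis
      using \<delta>_eq eu[of "- \<delta>"] sq by (simp add: \<delta>_def map_poly_id)
  qed
  then obtain E1 \<psi>1 where 1: "base_hom E1 \<psi>1" "\<delta> \<in> E1" "\<psi>1 \<delta> = - \<delta>"
    using extend_with_image[of \<delta> "- \<delta>"] by metis
  have "finite (ac_roots f)"
    using roots by simp
  then obtain E \<psi> where 2: "base_hom E \<psi>" "E1 \<subseteq> E" "ac_roots f \<subseteq> E" "\<forall>x\<in>E1. \<psi> x = \<psi>1 x"
    using base_hom.extend_finite[OF 1(1)] by metis
  interpret h: base_hom E \<psi>
    by fact
  define \<pi> where "\<pi> = restrict_id \<psi> (ac_roots f)"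
  have \<pi>: "\<pi> permutes {r1, r2, r3, r4}" "evenperm \<pi>"
    using alternating_automorphism_even[OF alt h.in_automorphisms[OF 2(3) \<open>f \<noteq> 0\<close>]]
    by (auto simp: \<pi>_def roots)
  have "- \<delta> = \<psi> \<delta>"
    using 1 2 by auto
  also have "\<dots> = vandermonde4 (\<psi> r1) (\<psi> r2) (\<psi> r3) (\<psi> r4)"
    using 2(3) by (simp add: \<delta>_def vandermonde4_def roots)
  also have "\<dots> = vandermonde4 (\<pi> r1) (\<pi> r2) (\<pi> r3) (\<pi> r4)"
    by (simp add: \<pi>_def restrict_id_def roots)
  also have "\<dots> = \<delta>"
    using vandermonde4_permute[OF \<pi>(1) dist, of "\<lambda>x. x"] \<pi>(2) by (simp add: \<delta>_def sign_def)
  \<comment> \<open>In characteristic zero \<open>- \<delta> = \<delta>\<close> gives \<delta> = 0,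
    an element of the base field.\<close>
  finally show False
    using \<delta> zero_closed by auto
qed

section \<open>Invariants of binary quartics\<close>

text \<open>The argument is a coefficient sequence, so that one formula serves quartics over a
  field, over the rational functions, and whole pencils whose coefficients are polynomials in the
  parameter.\<close>

definition quartic_I :: "(nat \<Rightarrow> 'a::comm_ring_1) \<Rightarrow> 'a" where
  "quartic_I f = 12 * f 4 * f 0 - 3 * f 3 * f 1 + f 2 ^ 2"

definition quartic_J :: "(nat \<Rightarrow> 'a::comm_ring_1) \<Rightarrow> 'a" where
  "quartic_J f = 72 * f 4 * f 2 * f 0 + 9 * f 3 * f 2 * f 1 - 27 * f 4 * f 1 ^ 2
     - 27 * f 0 * f 3 ^ 2 - 2 * f 2 ^ 3"

text \<open>The first and second derivatives of the invariants at \<open>f\<close> in the direction \<open>g\<close>.\<close>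

definition quartic_I' :: "(nat \<Rightarrow> 'a::comm_ring_1) \<Rightarrow> (nat \<Rightarrow> 'a) \<Rightarrow> 'a" where
  "quartic_I' f g = 12 * (f 4 * g 0 + g 4 * f 0) - 3 * (f 3 * g 1 + g 3 * f 1) + 2 * f 2 * g 2"

definition quartic_J' :: "(nat \<Rightarrow> 'a::comm_ring_1) \<Rightarrow> (nat \<Rightarrow> 'a) \<Rightarrow> 'a" where
  "quartic_J' f g = 72 * (g 4 * f 2 * f 0 + f 4 * g 2 * f 0 + f 4 * f 2 * g 0)
     + 9 * (g 3 * f 2 * f 1 + f 3 * g 2 * f 1 + f 3 * f 2 * g 1)
     - 27 * (g 4 * f 1 ^ 2 + 2 * f 4 * f 1 * g 1) - 27 * (g 0 * f 3 ^ 2 + 2 * f 0 * f 3 * g 3)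
     - 6 * f 2 ^ 2 * g 2"

definition quartic_J'' :: "(nat \<Rightarrow> 'a::comm_ring_1) \<Rightarrow> (nat \<Rightarrow> 'a) \<Rightarrow> 'a" where
  "quartic_J'' f g = 144 * (g 4 * g 2 * f 0 + g 4 * f 2 * g 0 + f 4 * g 2 * g 0)
     + 18 * (g 3 * g 2 * f 1 + g 3 * f 2 * g 1 + f 3 * g 2 * g 1)
     - 54 * (2 * g 4 * f 1 * g 1 + f 4 * g 1 ^ 2) - 54 * (2 * g 0 * f 3 * g 3 + f 0 * g 3 ^ 2)
     - 12 * f 2 * g 2 ^ 2"

text \<open>The homogenized quartic at the point \<open>m / l\<close> of the projective line, with
  infinity at \<open>l = 0\<close>.\<close>

definition quartic_form :: "(nat \<Rightarrow> 'a::comm_ring_1) \<Rightarrow> 'a \<Rightarrow> 'a \<Rightarrow> 'a" where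
  "quartic_form g m l = g 4 * m ^ 4 + g 3 * m ^ 3 * l + g 2 * m ^ 2 * l ^ 2 + g 1 * m * l ^ 3 + g 0 * l ^ 4"

lemmas quartic_defs = quartic_I_def quartic_J_def quartic_I'_def quartic_J'_def quartic_J''_def
  quartic_form_def

text \<open>The polynomial variable is the parameter \<open>u\<close> of \<open>u * g - b\<close>;
  the variable X of the quartic survives only as the index \<open>i\<close>.\<close>

definition pencil :: "(nat \<Rightarrow> 'a::comm_ring_1) \<Rightarrow> (nat \<Rightarrow> 'a) \<Rightarrow> nat \<Rightarrow> 'a poly" where
  "pencil g b i = [:- b i, g i:]"

text \<open>The member at \<open>u\<close> moves in the constant direction \<open>g\<close>, so
  derivatives in \<open>u\<close> are directional derivatives of the invariants. As I is quadratic,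
  its second derivative is constant.\<close>

lemma poly_pencil_invariants:
  fixes g b :: "nat \<Rightarrow> 'a::idom"
  defines "f \<equiv> \<lambda>u i. u * g i - b i"
  shows "poly (quartic_I (pencil g b)) u = quartic_I (f u)"
    "poly (quartic_J (pencil g b)) u = quartic_J (f u)"
    "poly (pderiv (quartic_I (pencil g b))) u = quartic_I' (f u) g"
    "poly (pderiv (quartic_J (pencil g b))) u = quartic_J' (f u) g"
    "poly (pderiv (pderiv (quartic_I (pencil g b)))) u = 2 * quartic_I g"
    "poly (pderiv (pderiv (quartic_J (pencil g b)))) u = quartic_J'' (f u) g"
  unfolding quartic_defs pencil_def f_def
  by (simp_all add: pderiv_mult pderiv_add pderiv_diff pderiv_power pderiv_pCons pderiv_smult
      algebra_simps power2_eq_square power3_eq_cube flip: numeral_mult_conv_smult)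

section \<open>Invariants and their variation at a multiple root\<close>

lemma coeff_double_root:
  fixes l m a b c :: "'a::idom"
  defines "f \<equiv> [:- m, l:] ^ 2 * [:c, b, a:]"
  shows "coeff f 4 = l^2*a" "coeff f 3 = l^2*b - 2*l*m*a" "coeff f 2 = l^2*c - 2*l*m*b + m^2*a"
    "coeff f 1 = m^2*b - 2*l*m*c" "coeff f 0 = m^2*c"
  by (simp_all add: f_def power2_eq_square numeral_eq_Suc algebra_simps)

text \<open>The base of the square is the complementary quadratic evaluated at the double root. Call
  it h: it vanishes exactly when that root is at least triple.\<close>

lemma double_root_I:
  fixes l m a b c :: "'a::idom"
  shows "quartic_I (coeff ([:- m, l:] ^ 2 * [:c, b, a:])) = (a*m^2 + b*m*l + c*l^2)^2"
  unfolding quartic_I_def coeff_double_root by Groebner_Basis.algebra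

lemma double_root_J:
  fixes l m a b c :: "'a::idom"
  shows "quartic_J (coeff ([:- m, l:] ^ 2 * [:c, b, a:])) = - 2 * (a*m^2 + b*m*l + c*l^2)^3"
  unfolding quartic_J_def coeff_double_root by Groebner_Basis.algebra

text \<open>With I = h^2 and J = -2 h^3, the derivative of 4 I^3 - J^2 in direction \<open>g\<close>
  is 4 h^3 times the left side. If it vanishes while h and \<open>g\<close> at the double root do
  not, the complementary quadratic has discriminant zero.\<close>

lemma double_root_first_order:
  fixes l m a b c :: "'a::idom"
  defines "f \<equiv> [:- m, l:] ^ 2 * [:c, b, a:]"
  shows "3 * (a*m^2 + b*m*l + c*l^2) * quartic_I' (coeff f) g + quartic_J' (coeff f) g =
      27 * (4*a*c - b^2) * quartic_form g m l"
  unfolding f_def quartic_I'_def quartic_J'_def quartic_form_def coeff_double_root by Groebner_Basis.algebra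

text \<open>Here \<open>f\<close> is the square of (l X - m)(r X - s), and the first-order identity
  gives J' = -3 h I'. The second derivative of 4 I^3 - J^2 is then \<open>h^2\<close> times the left
  side, nonzero unless h vanishes or \<open>g\<close> vanishes at one of the two roots.\<close>

lemma square_second_order:
  fixes l m r s :: "'a::idom"
  defines "f \<equiv> [:- m, l:] ^ 2 * [:s^2, -2*r*s, r^2:]" and "h \<equiv> (r*m - s*l)^2"
  shows "6 * quartic_I' (coeff f) g ^ 2 + 24 * h^2 * quartic_I g + 4 * h * quartic_J'' (coeff f) g
    = 864 * quartic_form g m l * quartic_form g s r"
  unfolding f_def h_def quartic_I'_def quartic_J''_def quartic_I_def quartic_form_def coeff_double_root
  by Groebner_Basis.algebra

text \<open>The quartic is (l X - m)^3 (a X + b), and \<open>a*m + b*l\<close> measures whether the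
  root of the last factor coincides with the triple root.\<close>

lemma triple_root_J':
  fixes l m a b :: "'a::idom"
  shows "quartic_J' (coeff ([:- m, l:] ^ 2 * [:- (m*b), l*b - m*a, l*a:])) g =
    - 27 * (a*m + b*l)^2 * quartic_form g m l"
  unfolding quartic_J'_def quartic_form_def coeff_double_root by Groebner_Basis.algebra

lemma quadruple_root_I':
  fixes l m k :: "'a::idom"
  shows "quartic_I' (coeff ([:- m, l:] ^ 2 * [:m^2*k, -2*l*m*k, l^2*k:])) g = 12 * k * quartic_form g m l"
  unfolding quartic_I'_def quartic_form_def coeff_double_root by Groebner_Basis.algebra

section \<open>Discriminant and multiple roots\<close>

lemma quartic_discriminant_roots:
  fixes f :: "nat \<Rightarrow> 'a::idom"
  assumes "f 4 = a" "f 3 = - a*(p+q+r+s)" "f 2 = a*(p*q+p*r+p*s+q*r+q*s+r*s)"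
    "f 1 = -a*(p*q*r+p*q*s+p*r*s+q*r*s)" "f 0 = a*p*q*r*s"
  shows "4 * quartic_I f ^ 3 - quartic_J f ^ 2 = 27 * (a^3 * vandermonde4 p q r s)^2"
proof -
  \<comment> \<open>The three products (p-q)(r-s), (p-r)(s-q) and (p-s)(q-r) add up to zero, so two
    of them express both invariants and reduce the claim to an identity in two variables.\<close>
  define x where "x = (p-q)*(r-s)"
  define y where "y = (p-r)*(s-q)"
  have "quartic_I f = a^2 * (x^2+x*y+y^2)"
    unfolding x_def y_def quartic_I_def assms by Groebner_Basis.algebra
  moreover have "quartic_J f = a^3 * ((y-x)*(2*y+x)*(2*x+y))"
    unfolding x_def y_def quartic_J_def assms by Groebner_Basis.algebra
  ultimately have "4 * quartic_I f ^ 3 - quartic_J f ^ 2 =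
      4 * (a^2 * (x^2+x*y+y^2)) ^ 3 - (a^3 * ((y-x)*(2*y+x)*(2*x+y))) ^ 2"
    by simp
  also have "\<dots> = 27 * (a^3 * (x*y*(x+y)))^2"
    by Groebner_Basis.algebra
  also have "x*y*(x+y) = vandermonde4 p q r s"
    unfolding x_def y_def vandermonde4_def by Groebner_Basis.algebra
  finally show ?thesis .
qed

text \<open>This covers a root at infinity, where the quartic discriminant is \<open>a^2\<close>
  times the discriminant of the cubic.\<close>

lemma cubic_discriminant_roots:
  fixes f :: "nat \<Rightarrow> 'a::idom"
  assumes "f 4 = 0" "f 3 = a" "f 2 = -a*(p+q+r)" "f 1 = a*(p*q+p*r+q*r)" "f 0 = -a*p*q*r"
  shows "4 * quartic_I f ^ 3 - quartic_J f ^ 2 = 27 * (a^3*((p-q)*(p-r)*(q-r)))^2"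
  unfolding quartic_defs assms by Groebner_Basis.algebra

lemma poly_degree_le_2:
  assumes "degree g \<le> 2"
  shows "g = [:coeff g 0, coeff g 1, coeff g 2:]"
proof (rule poly_eqI)
  fix i :: nat
  consider "i = 0" | "i = 1" | "i = 2" | "i > 2"
    by linarith
  then show "coeff g i = coeff [:coeff g 0, coeff g 1, coeff g 2:] i"
    using assms by cases (auto simp: coeff_eq_0 numeral_2_eq_2 coeff_pCons split: nat.splits)
qed

lemma quartic_linear_factors:
  fixes a p q r s :: "'a::idom"
  defines "f \<equiv> smult a ([:- p, 1:] * [:- q, 1:] * [:- r, 1:] * [:- s, 1:])"
  shows "4 * quartic_I (coeff f) ^ 3 - quartic_J (coeff f) ^ 2 = 27 * (a^3 * vandermonde4 p q r s)^2"
  by (rule quartic_discriminant_roots) (simp_all add: f_def numeral_eq_Suc algebra_simps)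

lemma repeated_linear_factor:
  fixes f :: "'a::field poly"
  assumes f: "f = smult k (\<Prod>x\<in>#A. [:- x, 1:])" and "2 \<le> count A x" "f \<noteq> 0" "degree f \<le> 4"
  shows "\<exists>a b c. f = [:- x, 1:] ^ 2 * [:c, b, a:]"
proof -
  have "{#x, x#} \<subseteq># A"
    using assms(2) by (intro mset_subset_eqI) auto
  then obtain B where B: "A = {#x, x#} + B"
    by (auto simp: mset_subset_eq_exists_conv)
  define g where "g = smult k (\<Prod>y\<in>#B. [:- y, 1:])"
  have fg: "f = [:- x, 1:] ^ 2 * g"
    unfolding f B g_def power2_eq_square by (simp add: mult.assoc del: mult_pCons_left mult_pCons_right)
  then have "g \<noteq> 0"
    using assms(3) by auto
  then have "degree f = 2 + degree g"
    unfolding fg by (subst degree_mult_eq) (auto simp: degree_power_eq)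
  then have "g = [:coeff g 0, coeff g 1, coeff g 2:]"
    using assms(4) by (intro poly_degree_le_2) simp
  then show ?thesis
    using fg by metis
qed

lemma size_eq_Suc_iff: "size M = Suc n \<longleftrightarrow> (\<exists>x N. M = add_mset x N \<and> size N = n)"
  by (metis nat.inject size_add_mset size_eq_Suc_imp_eq_union)

text \<open>Quartics are treated as binary forms: \<open>l = 0\<close> is the root at infinity.\<close>

lemma quartic_double_root:
  fixes f :: "'a::{alg_closed_field,field_char_0} poly"
  assumes "f \<noteq> 0" "degree f \<le> 4" and disc: "4 * quartic_I (coeff f) ^ 3 = quartic_J (coeff f) ^ 2"
  obtains l m a b c where "l \<noteq> 0 \<or> m \<noteq> 0" "f = [:- m, l:] ^ 2 * [:c, b, a:]"
proof (cases "degree f \<le> 2")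
  case True
  \<comment> \<open>Degree at most 2 means a double root at infinity, the point
    \<open>l = 0\<close>, \<open>m = 1\<close>, whose linear form is the constant -1.\<close>
  have "f = [:- 1, 0:] ^ 2 * [:coeff f 0, coeff f 1, coeff f 2:]"
    using poly_degree_le_2[OF True] by (simp add: power2_eq_square)
  then show thesis
    using that[of 0 1] by simp
next
  case False
  obtain A where A: "size A = degree f" "f = smult (lead_coeff f) (\<Prod>x\<in>#A. [:- x, 1:])"
    using alg_closed_imp_factorization[OF assms(1)] by blast
  define k where "k = lead_coeff f"
  have k: "k \<noteq> 0" "f = smult k (\<Prod>x\<in>#A. [:- x, 1:])"
    using assms(1) A by (auto simp: k_def)
  have "\<exists>x. 2 \<le> count A x"
  proof (cases "degree f = 4")
    case True
    with A(1) have "size A = Suc (Suc (Suc (Suc 0)))"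
      by simp
    then obtain p q r s where pqrs: "A = {#p, q, r, s#}"
      by (auto simp: size_eq_Suc_iff)
    then have "f = smult k ([:- p, 1:] * [:- q, 1:] * [:- r, 1:] * [:- s, 1:])"
      using k(2) by (simp add: mult.assoc del: mult_pCons_left mult_pCons_right)
    then have "k ^ 3 * vandermonde4 p q r s = 0"
      using quartic_linear_factors[of k p q r s] disc by simp
    then show ?thesis
      using k(1) pqrs
      by (auto simp: vandermonde4_def intro: exI[of _ q] exI[of _ r] exI[of _ s])
  next
    case False
    with \<open>\<not> degree f \<le> 2\<close> assms(2) A(1) have "size A = Suc (Suc (Suc 0))"
      by simp
    then obtain p q r where pqr: "A = {#p, q, r#}"
      by (auto simp: size_eq_Suc_iff)
    then have "f = smult k ([:- p, 1:] * [:- q, 1:] * [:- r, 1:])"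
      using k(2) by (simp add: mult.assoc del: mult_pCons_left mult_pCons_right)
    then have "4 * quartic_I (coeff f) ^ 3 - quartic_J (coeff f) ^ 2 = 27 * (k^3 * ((p-q)*(p-r)*(q-r)))^2"
      by (intro cubic_discriminant_roots) (simp_all add: numeral_eq_Suc algebra_simps)
    then show ?thesis
      using disc k(1) pqr by (auto intro: exI[of _ q] exI[of _ r])
  qed
  then obtain x where "2 \<le> count A x"
    by blast
  then obtain a b c where "f = [:- x, 1:] ^ 2 * [:c, b, a:]"
    using repeated_linear_factor[OF k(2)] assms by blast
  then show thesis
    using that[of 1 x] by simp
qed

lemma zero_discriminant_square:
  fixes a b c :: "'a::{alg_closed_field,field_char_0}"
  assumes "4 * a * c - b ^ 2 = 0"
  obtains r s where "a = r ^ 2" "b = - 2 * r * s" "c = s ^ 2"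
proof -
  obtain r where r: "a = r ^ 2"
    using nth_root_exists[of 2 a] by auto
  show thesis
  proof (cases "r = 0")
    case True
    then show thesis
      using nth_root_exists[of 2 c] r assms that[of 0] by auto
  next
    case False
    show thesis
    proof (rule that[OF r])
      show b: "b = - 2 * r * (- b / (2 * r))"
        using False by (simp add: field_simps)
      show "c = (- b / (2 * r)) ^ 2"
        using False assms r by (simp add: field_simps power2_eq_square)
    qed
  qed
qed

lemma quadratic_form_root_factor:
  fixes a b c l m :: "'a::field"
  assumes "a*m^2 + b*m*l + c*l^2 = 0" "l \<noteq> 0 \<or> m \<noteq> 0"
  obtains a' b' where "a = l * a'" "b = l * b' - m * a'" "c = - (m * b')"
proof (cases "l = 0")
  case True
  then show thesis
    using assms that[of "- b / m" "- c / m"] by auto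
next
  case False
  have "c * l ^ 2 = - m * (b * l + m * a)"
    using assms(1) by (simp add: algebra_simps power2_eq_square add_eq_0_iff)
  then show thesis
    using False that[of "a / l" "(b + m * a / l) / l"]
    by (auto simp: field_simps power2_eq_square)
qed

text \<open>The equation is differentiated zero to three times and evaluated at a zero of
  \<open>D\<close>. In the last claim only the term 24 I'^3 of the third derivative
  survives.\<close>

lemma discriminant_derivatives:
  fixes D I J :: "'a::field_char_0 poly"
  assumes eq: "27 * D ^ 2 = 4 * I ^ 3 - J ^ 2" and u: "poly D u = 0"
  defines "ev \<equiv> \<lambda>p. poly p u"
  shows "4 * ev I ^ 3 = ev J ^ 2"
    "6 * ev I ^ 2 * ev (pderiv I) = ev J * ev (pderiv J)"
    "27 * ev (pderiv D) ^ 2 = 12 * ev I * ev (pderiv I) ^ 2 + 6 * ev I ^ 2 * ev (pderiv (pderiv I))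
       - ev (pderiv J) ^ 2 - ev J * ev (pderiv (pderiv J))"
    "ev I = 0 \<Longrightarrow> ev J = 0 \<Longrightarrow> ev (pderiv J) = 0 \<Longrightarrow> ev (pderiv D) = 0 \<Longrightarrow> ev (pderiv I) = 0"
proof -
  have 0: "27 * (D * D) = 4 * (I * I * I) - J * J"
    using eq by (simp add: power2_eq_square power3_eq_cube)
  show "4 * ev I ^ 3 = ev J ^ 2"
    using arg_cong[OF eq, of "\<lambda>p. poly p u"] u by (simp add: ev_def)
  have d1: "pderiv (27 * (D * D)) = pderiv (4 * (I * I * I) - J * J)"
    using 0 by simp
  have d2: "pderiv (pderiv (27 * (D * D))) = pderiv (pderiv (4 * (I * I * I) - J * J))"
    using d1 by simp
  have d3: "pderiv (pderiv (pderiv (27 * (D * D)))) = pderiv (pderiv (pderiv (4 * (I * I * I) - J * J)))"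
    using d2 by simp
  note pd = pderiv_mult pderiv_add pderiv_diff pderiv_numeral
  have "2 * (6 * ev I ^ 2 * ev (pderiv I)) = 2 * (ev J * ev (pderiv J))"
    using arg_cong[OF d1, of "\<lambda>p. poly p u"] u
    by (simp add: ev_def pd algebra_simps power2_eq_square)
  then show "6 * ev I ^ 2 * ev (pderiv I) = ev J * ev (pderiv J)"
    using mult_left_cancel[of "2::'a"] by (metis zero_neq_numeral)
  have "2 * (27 * ev (pderiv D) ^ 2) = 2 * (12 * ev I * ev (pderiv I) ^ 2
      + 6 * ev I ^ 2 * ev (pderiv (pderiv I)) - ev (pderiv J) ^ 2 - ev J * ev (pderiv (pderiv J)))"
    using arg_cong[OF d2, of "\<lambda>p. poly p u"] u
    by (simp add: ev_def pd algebra_simps power2_eq_square)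
  then show "27 * ev (pderiv D) ^ 2 = 12 * ev I * ev (pderiv I) ^ 2
      + 6 * ev I ^ 2 * ev (pderiv (pderiv I)) - ev (pderiv J) ^ 2 - ev J * ev (pderiv (pderiv J))"
    using mult_left_cancel[of "2::'a"] by (metis zero_neq_numeral)
  show "ev (pderiv I) = 0" if "ev I = 0" "ev J = 0" "ev (pderiv J) = 0" "ev (pderiv D) = 0"
    using arg_cong[OF d3, of "\<lambda>p. poly p u"] u that
    by (simp add: ev_def pd algebra_simps)
qed

lemma poly_quartic_form:
  fixes g :: "'a::field poly"
  assumes "degree g \<le> 4" "l \<noteq> 0"
  shows "quartic_form (coeff g) m l = l ^ 4 * poly g (m / l)"
proof -
  have "poly g (m / l) = (\<Sum>i\<le>4. coeff g i * (m / l) ^ i)"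
    unfolding poly_altdef using assms(1) by (intro sum.mono_neutral_left) (auto simp: coeff_eq_0)
  also have "\<dots> = coeff g 0 + coeff g 1 * (m / l) + coeff g 2 * (m / l) ^ 2 + coeff g 3 * (m / l) ^ 3
      + coeff g 4 * (m / l) ^ 4"
    by (simp add: numeral_eq_Suc)
  finally show ?thesis
    using assms(2) by (simp add: quartic_form_def field_simps power_divide numeral_eq_Suc)
qed


section \<open>Pencils of quartics with square discriminant\<close>

locale quartic_pencil =
  fixes A B D :: "'a::{alg_closed_field,field_char_0} poly"
  assumes deg_A: "degree A = 4" and deg_B: "degree B \<le> 3"
    and no_common_root: "\<And>x. poly A x = 0 \<Longrightarrow> poly B x \<noteq> 0"
    and disc: "27 * D ^ 2 = 4 * quartic_I (pencil (coeff A) (coeff B)) ^ 3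
      - quartic_J (pencil (coeff A) (coeff B)) ^ 2"
begin

abbreviation I :: "'a poly" where "I \<equiv> quartic_I (pencil (coeff A) (coeff B))"
abbreviation J :: "'a poly" where "J \<equiv> quartic_J (pencil (coeff A) (coeff B))"
abbreviation F :: "'a \<Rightarrow> 'a poly" where "F u \<equiv> smult u A - B"

lemma coeff_F: "coeff (F u) = (\<lambda>i. u * coeff A i - coeff B i)"
  by auto

lemma F_nonzero: "F u \<noteq> 0"
proof
  assume "F u = 0"
  then have eq: "smult u A = B"
    by simp
  obtain x where x: "poly A x = 0"
    using alg_closed_imp_poly_has_root[of A] deg_A by auto
  then have "poly B x = 0"
    using eq[symmetric] by simp
  with x show False
    using no_common_root by auto
qed

lemma degree_F: "degree (F u) \<le> 4"
  using deg_A deg_B by (intro degree_diff_le) (auto intro: order.trans[OF degree_smult_le])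

text \<open>The pencil has no base point: a finite root shared by \<open>F u\<close> and
  \<open>A\<close> would also be a root of \<open>B\<close>, and \<open>A\<close> has exact degree
  4, so it does not vanish at infinity.\<close>

lemma form_nonzero:
  assumes "F u = [:- m, l:] * g" "l \<noteq> 0 \<or> m \<noteq> 0"
  shows "quartic_form (coeff A) m l \<noteq> 0"
proof (cases "l = 0")
  case True
  moreover have "coeff A 4 \<noteq> 0"
    using deg_A by (metis degree_0 leading_coeff_0_iff zero_neq_numeral)
  ultimately show ?thesis
    using assms(2) by (simp add: quartic_form_def)
next
  case False
  have "poly (F u) (m / l) = 0"
    using False by (simp add: assms(1))
  then have "poly A (m / l) \<noteq> 0"
    using no_common_root[of "m / l"] by auto
  then show ?thesis
    using False deg_A by (simp add: poly_quartic_form)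
qed

text \<open>Let h be the complementary quadratic at the double root. If h is nonzero, first order
  makes \<open>F u\<close> a square, and D' = 0 contradicts the second-order identity. If h is zero,
  D' = 0 forces J' = 0, hence a quadruple root; third order then gives I' = 0, which makes
  \<open>F u\<close> vanish.\<close>

lemma at_root:
  assumes u: "poly D u = 0"
  shows "poly (pderiv D) u \<noteq> 0" "poly I u \<noteq> 0 \<Longrightarrow> \<exists>q. degree q \<le> 2 \<and> F u = q ^ 2"
proof -
  note ev = poly_pencil_invariants[of "coeff A" "coeff B" u, folded coeff_F]
  note rel = discriminant_derivatives[OF disc u, unfolded ev]
  obtain l m a b c where lm: "l \<noteq> 0 \<or> m \<noteq> 0" and F: "F u = [:- m, l:] ^ 2 * [:c, b, a:]"
    by (rule quartic_double_root[OF F_nonzero degree_F rel(1)])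
  have "F u = [:- m, l:] * ([:- m, l:] * [:c, b, a:])"
    using F by (simp only: power2_eq_square mult.assoc)
  from form_nonzero[OF this lm] have form: "quartic_form (coeff A) m l \<noteq> 0" .
  define h where "h = a*m^2 + b*m*l + c*l^2"
  define i1 where "i1 = quartic_I' (coeff (F u)) (coeff A)"
  define j1 where "j1 = quartic_J' (coeff (F u)) (coeff A)"
  define i2 where "i2 = quartic_I (coeff A)"
  define j2 where "j2 = quartic_J'' (coeff (F u)) (coeff A)"
  have IJ: "quartic_I (coeff (F u)) = h ^ 2" "quartic_J (coeff (F u)) = - 2 * h ^ 3"
    unfolding F h_def by (rule double_root_I double_root_J)+
  note rel = rel[unfolded IJ, folded i1_def i2_def j1_def j2_def]
  have first: "3 * h * i1 + j1 = 27 * (4*a*c - b^2) * quartic_form (coeff A) m l"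
    unfolding F h_def i1_def j1_def by (rule double_root_first_order)
  have square: "\<exists>r s. a = r^2 \<and> b = - 2*r*s \<and> c = s^2" if "h \<noteq> 0"
  proof -
    have "4 * h ^ 3 * (3 * h * i1 + j1) = 0"
      using rel(2) by Groebner_Basis.algebra
    then have "4*a*c - b^2 = 0"
      using that form unfolding first by (simp add: mult.assoc)
    then show ?thesis
      by (metis zero_discriminant_square)
  qed
  show "\<exists>q. degree q \<le> 2 \<and> F u = q ^ 2" if "poly I u \<noteq> 0"
  proof -
    have "h \<noteq> 0"
      using that unfolding ev IJ by auto
    then obtain r s where rs: "a = r^2" "b = - 2*r*s" "c = s^2"
      using square by blast
    have "F u = ([:- m, l:] * [:- s, r:]) ^ 2"
      unfolding F rs by (simp add: power2_eq_square algebra_simps)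
    moreover have "degree ([:- m, l:] * [:- s, r:]) \<le> 2"
      by (rule order.trans[OF degree_mult_le]) auto
    ultimately show ?thesis
      by blast
  qed
  show "poly (pderiv D) u \<noteq> 0"
  proof
    assume D': "poly (pderiv D) u = 0"
    show False
    proof (cases "h = 0")
      case False
      then obtain r s where rs: "a = r^2" "b = - 2*r*s" "c = s^2"
        using square by blast
      have h: "h = (r*m - s*l)^2"
        unfolding h_def rs by (simp add: power2_eq_square algebra_simps)
      have "4*a*c - b^2 = 0"
        unfolding rs by (simp add: power2_eq_square)
      then have j1: "j1 = - (3 * h * i1)"
        using first by (simp add: add_eq_0_iff)
      have "r \<noteq> 0 \<or> s \<noteq> 0"
        using h False by auto
      moreover have "[:- m, l:] ^ 2 * [:s ^ 2, - 2 * r * s, r ^ 2:]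
          = [:- s, r:] * ([:- m, l:] ^ 2 * [:- s, r:])"
        by (simp add: power2_eq_square algebra_simps)
      ultimately have form': "quartic_form (coeff A) s r \<noteq> 0"
        using F rs by (intro form_nonzero[of u s r "[:- m, l:] ^ 2 * [:- s, r:]"]) simp_all
      \<comment> \<open>Twice the second-order relation, with D' = 0 and J' = -3 h I'
        inserted.\<close>
      have "0 = 2 * (12 * h^2 * i1^2 + 6 * (h^2)^2 * (2 * i2) - (- (3 * h * i1))^2 - - 2 * h^3 * j2)"
        using rel(3) unfolding D' j1 by (simp only: zero_power2 mult_zero_right)
      also have "\<dots> = h ^ 2 * (6 * i1 ^ 2 + 24 * h ^ 2 * i2 + 4 * h * j2)"
        by Groebner_Basis.algebra
      also have "\<dots> = h ^ 2 * (864 * quartic_form (coeff A) m l * quartic_form (coeff A) s r)"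
        unfolding i1_def i2_def j2_def F rs h by (subst square_second_order) simp
      finally show False
        using False form form' by simp
    next
      case True
      then obtain a' b' where ab: "a = l * a'" "b = l * b' - m * a'" "c = - (m * b')"
        using quadratic_form_root_factor[of a m b l c] lm unfolding h_def by metis
      have "j1 = 0"
        using rel(3) unfolding D' True by simp
      then have "a' * m + b' * l = 0"
        using form unfolding j1_def F ab triple_root_J' by simp
      then obtain k where k: "a' = l * k" "b' = - (m * k)"
      proof (cases "l = 0")
        case True
        then show thesis
          using \<open>a' * m + b' * l = 0\<close> lm that[of "- b' / m"] by auto
      next
        case False
        then show thesis
          using \<open>a' * m + b' * l = 0\<close> that[of "a' / l"] by (auto simp: field_simps add_eq_0_iff)
      qed
      have Fk: "F u = [:- m, l:] ^ 2 * [:m^2*k, -2*l*m*k, l^2*k:]"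
        unfolding F ab k by (simp add: power2_eq_square algebra_simps)
      have "i1 = 0"
        using rel(4) True \<open>j1 = 0\<close> D' by simp
      then have "k = 0"
        using form unfolding i1_def Fk quadruple_root_I' by simp
      then show False
        using F_nonzero[of u] unfolding Fk by simp
    qed
  qed
qed

end

section \<open>Change of field\<close>

text \<open>One locale serves \<open>of_rat\<close>, \<open>to_ac\<close>, complex conjugation and
  the embedding of constants into the rational functions.\<close>

locale field_emb =
  fixes \<iota> :: "'a::field \<Rightarrow> 'b::field"
  assumes emb_add: "\<iota> (x + y) = \<iota> x + \<iota> y" and emb_mult: "\<iota> (x * y) = \<iota> x * \<iota> y"
    and emb_one: "\<iota> 1 = 1"
begin

lemma emb_zero [simp]: "\<iota> 0 = 0"
  using emb_add[of 0 0] by (metis add.right_neutral add_left_cancel)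

lemma emb_uminus: "\<iota> (- x) = - \<iota> x"
  using emb_add[of x "- x"] by (simp add: add_eq_0_iff)

lemma emb_diff: "\<iota> (x - y) = \<iota> x - \<iota> y"
  using emb_add[of x "- y"] by (simp add: emb_uminus)

lemma emb_of_nat: "\<iota> (of_nat n) = of_nat n"
  by (induction n) (auto simp: emb_add emb_one)

lemma emb_numeral: "\<iota> (numeral n) = numeral n"
  using emb_of_nat[of "numeral n"] by simp

lemma emb_power: "\<iota> (x ^ n) = \<iota> x ^ n"
  by (induction n) (auto simp: emb_mult emb_one)

lemma emb_sum: "\<iota> (sum f A) = (\<Sum>x\<in>A. \<iota> (f x))"
  by (induction A rule: infinite_finite_induct) (auto simp: emb_add)

lemma emb_eq_0_iff [simp]: "\<iota> x = 0 \<longleftrightarrow> x = 0"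
proof
  assume "\<iota> x = 0"
  then have "\<iota> (x * inverse x) = 0"
    by (simp add: emb_mult)
  then show "x = 0"
    by (cases "x = 0") (auto simp: emb_one)
qed simp

lemma emb_eq_iff: "\<iota> x = \<iota> y \<longleftrightarrow> x = y"
  using emb_eq_0_iff[of "x - y"] by (simp add: emb_diff)

lemmas emb_simps = emb_add emb_mult emb_one emb_uminus emb_diff emb_numeral emb_power

lemma coeff_map_emb: "coeff (map_poly \<iota> p) i = \<iota> (coeff p i)"
  by (simp add: coeff_map_poly)

lemma map_emb_add: "map_poly \<iota> (p + q) = map_poly \<iota> p + map_poly \<iota> q"
  by (rule poly_eqI) (simp add: coeff_map_emb emb_add)

lemma map_emb_diff: "map_poly \<iota> (p - q) = map_poly \<iota> p - map_poly \<iota> q"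
  by (rule poly_eqI) (simp add: coeff_map_emb emb_diff)

lemma map_emb_mult: "map_poly \<iota> (p * q) = map_poly \<iota> p * map_poly \<iota> q"
  by (rule poly_eqI) (simp add: coeff_map_emb coeff_mult emb_sum emb_mult)

lemma map_emb_smult: "map_poly \<iota> (smult c p) = smult (\<iota> c) (map_poly \<iota> p)"
  by (rule poly_eqI) (simp add: coeff_map_emb emb_mult)

lemma map_emb_pCons: "map_poly \<iota> (pCons c p) = pCons (\<iota> c) (map_poly \<iota> p)"
  by (rule map_poly_pCons) simp

lemma map_emb_one: "map_poly \<iota> 1 = 1"
  by (simp add: one_pCons map_emb_pCons emb_one)

lemma map_emb_numeral: "map_poly \<iota> (numeral n) = numeral n"
  by (simp add: numeral_poly map_emb_pCons emb_numeral)

lemma map_emb_power: "map_poly \<iota> (p ^ n) = map_poly \<iota> p ^ n"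
  by (induction n) (auto simp: map_emb_mult map_emb_one)

lemma degree_map_emb: "degree (map_poly \<iota> p) = degree p"
  by (rule degree_map_poly) simp

lemma map_emb_eq_iff: "map_poly \<iota> p = map_poly \<iota> q \<longleftrightarrow> p = q"
  by (auto simp: poly_eq_iff coeff_map_emb emb_eq_iff)

lemma poly_map_emb: "poly (map_poly \<iota> p) (\<iota> x) = \<iota> (poly p x)"
  by (induction p) (auto simp: map_emb_pCons emb_simps)

lemma map_emb_pencil: "pencil (coeff (map_poly \<iota> A)) (coeff (map_poly \<iota> B)) =
    (\<lambda>i. map_poly \<iota> (pencil (coeff A) (coeff B) i))"
  by (auto simp: pencil_def coeff_map_emb map_emb_pCons emb_uminus)

lemma map_emb_quartic_I: "quartic_I (\<lambda>i. map_poly \<iota> (f i)) = map_poly \<iota> (quartic_I f)"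
  by (simp add: quartic_I_def map_emb_add map_emb_diff map_emb_mult map_emb_power map_emb_numeral)

lemma map_emb_quartic_J: "quartic_J (\<lambda>i. map_poly \<iota> (f i)) = map_poly \<iota> (quartic_J f)"
  by (simp add: quartic_J_def map_emb_add map_emb_diff map_emb_mult map_emb_power map_emb_numeral)

text \<open>A Bezout identity survives every embedding; for this reason coprimality is carried in
  that form.\<close>

lemma no_common_root:
  assumes "a * P + b * Q = 1" "poly (map_poly \<iota> P) x = 0"
  shows "poly (map_poly \<iota> Q) x \<noteq> 0"
proof
  assume "poly (map_poly \<iota> Q) x = 0"
  then have "poly (map_poly \<iota> (a * P + b * Q)) x = 0"
    using assms(2) by (simp add: map_emb_add map_emb_mult)
  then show False
    by (simp add: assms(1) map_emb_one)
qed

end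

text \<open>A rational pencil is studied over two fields: the algebraic closure of the rationals,
  where the geometric group acts, and the complex numbers, which provide conjugation and
  positivity.\<close>

lemma quartic_pencil_map:
  fixes \<iota> :: "'a::field \<Rightarrow> 'b::{alg_closed_field,field_char_0}"
  assumes "field_emb \<iota>" and "degree A = 4" "degree B \<le> 3" "a * A + b * B = 1"
    and "27 * D ^ 2 = 4 * quartic_I (pencil (coeff A) (coeff B)) ^ 3
      - quartic_J (pencil (coeff A) (coeff B)) ^ 2"
  shows "quartic_pencil (map_poly \<iota> A) (map_poly \<iota> B) (map_poly \<iota> D)"
proof -
  interpret field_emb \<iota>
    by fact
  show ?thesis
  proof
    show "degree (map_poly \<iota> A) = 4" "degree (map_poly \<iota> B) \<le> 3"
      using assms by (simp_all add: degree_map_emb)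
    show "poly (map_poly \<iota> B) x \<noteq> 0" if "poly (map_poly \<iota> A) x = 0" for x
      using no_common_root[OF assms(4) that] .
    show "27 * map_poly \<iota> D ^ 2 =
        4 * quartic_I (pencil (coeff (map_poly \<iota> A)) (coeff (map_poly \<iota> B))) ^ 3
        - quartic_J (pencil (coeff (map_poly \<iota> A)) (coeff (map_poly \<iota> B))) ^ 2"
      using arg_cong[OF assms(5), of "map_poly \<iota>"] unfolding map_emb_pencil map_emb_quartic_I map_emb_quartic_J
      by (simp add: map_emb_diff map_emb_mult map_emb_power map_emb_numeral)
  qed
qed

text \<open>Vanishing of I makes the double root triple. Since \<open>u \<noteq> 0\<close>, the
  member keeps degree 4, so this root is finite and can be normalized to
  \<open>l = 1\<close>.\<close>

lemma (in quartic_pencil) triple_root: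
  assumes "poly D u = 0" "poly I u = 0" "u \<noteq> 0"
  obtains x a b where "F u = [:- x, 1:] ^ 3 * [:b, a:]"
proof -
  note ev = poly_pencil_invariants[of "coeff A" "coeff B" u, folded coeff_F]
  note rel = discriminant_derivatives[OF disc assms(1), unfolded ev]
  obtain l m a b c where lm: "l \<noteq> 0 \<or> m \<noteq> 0" and F: "F u = [:- m, l:] ^ 2 * [:c, b, a:]"
    by (rule quartic_double_root[OF F_nonzero degree_F rel(1)])
  have "(a*m^2 + b*m*l + c*l^2) ^ 2 = 0"
    using assms(2) unfolding ev F double_root_I .
  then obtain a' b' where ab: "a = l * a'" "b = l * b' - m * a'" "c = - (m * b')"
    using quadratic_form_root_factor[of a m b l c] lm by (metis zero_eq_power2)
  have "coeff A 4 \<noteq> 0"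
    using deg_A by (metis degree_0 leading_coeff_0_iff zero_neq_numeral)
  moreover have "coeff B 4 = 0"
    using deg_B by (intro coeff_eq_0) simp
  ultimately have "coeff (F u) 4 \<noteq> 0"
    using assms(3) by simp
  then have l: "l \<noteq> 0"
    unfolding F coeff_double_root by auto
  have "F u = [:- (m / l), 1:] ^ 3 * [:l ^ 3 * b', l ^ 3 * a':]"
    unfolding F ab using l by (simp add: power2_eq_square power3_eq_cube field_simps)
  then show thesis
    by (rule that)
qed

section \<open>Positivity\<close>

text \<open>Six times the apolar pairing of the quartic \<open>f\<close> with \<open>(X - x)\<^sup>2 (X - y)\<^sup>2\<close>.\<close>

definition apolar_form :: "'a::comm_ring_1 \<Rightarrow> 'a \<Rightarrow> (nat \<Rightarrow> 'a) \<Rightarrow> 'a" where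
  "apolar_form x y f = 6 * f 4 * (x * y) ^ 2 + 3 * f 3 * (x * y) * (x + y)
     + f 2 * ((x + y) ^ 2 + 2 * (x * y)) + 3 * f 1 * (x + y) + 6 * f 0"

text \<open>After moving the triple root to 0, the quartic has only terms of degree 3 and 4. They
  pair with the coefficients of degree 1 and 0 of the other quartic, which vanish because it has a
  double root there.\<close>

lemma apolar_form_triple:
  fixes x y a b :: "'a::idom"
  shows "apolar_form x y (coeff ([:- x, 1:] ^ 3 * [:b, a:])) = 0"
    "apolar_form x y (coeff ([:- y, 1:] ^ 3 * [:b, a:])) = 0"
  unfolding apolar_form_def
  by (simp_all add: power3_eq_cube power2_eq_square numeral_eq_Suc algebra_simps)

text \<open>For real \<open>q\<close> and conjugate \<open>x\<close>, \<open>y\<close> the right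
  side is a real square plus twice a squared modulus; this is the source of definiteness.\<close>

lemma apolar_form_square:
  fixes x y q0 q1 q2 :: "'a::idom"
  defines "q \<equiv> [:q0, q1, q2:]"
  shows "apolar_form x y (coeff (q ^ 2)) =
    (q1 * (x + y) + 2 * q0 + 2 * q2 * (x * y)) ^ 2 + 2 * poly q x * poly q y"
  unfolding apolar_form_def q_def
  by (simp add: power2_eq_square numeral_eq_Suc algebra_simps)

lemma nonneg_quadratic_discriminant:
  fixes a b c :: "'a::linordered_field"
  assumes nonneg: "\<And>x. a * x ^ 2 + b * x + c \<ge> 0" and "a \<noteq> 0"
  shows "a > 0" "b ^ 2 \<le> 4 * a * c"
proof -
  define v where "v = c - b ^ 2 / (4 * a)"
  have shift: "a * (s - b / (2 * a)) ^ 2 + b * (s - b / (2 * a)) + c = a * s ^ 2 + v" for s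
    using \<open>a \<noteq> 0\<close> by (simp add: v_def field_simps power2_eq_square)
  have ge: "a * s ^ 2 + v \<ge> 0" for s
    using nonneg[of "s - b / (2 * a)"] unfolding shift .
  have v: "v \<ge> 0"
    using ge[of 0] by simp
  show a: "a > 0"
  proof (rule ccontr)
    assume "\<not> a > 0"
    then have "a < 0"
      using \<open>a \<noteq> 0\<close> by simp
    \<comment> \<open>This \<open>s\<close> is at least 1 and satisfies
      \<open>a * s + v = a\<close>, so \<open>a * s ^ 2 + v\<close> is at most \<open>a\<close>,
      which is negative.\<close>
    define s where "s = 1 + v / (- a)"
    have "v / (- a) \<ge> 0"
      using v \<open>a < 0\<close> by (simp add: divide_nonneg_neg)
    then have "s \<le> s ^ 2"
      unfolding s_def by (intro self_le_power) simp_all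
    then have "a * s ^ 2 \<le> a * s"
      using \<open>a < 0\<close> by simp
    also have "a * s = a - v"
      using \<open>a < 0\<close> by (simp add: s_def field_simps)
    finally show False
      using ge[of s] \<open>a < 0\<close> by simp
  qed
  show "b ^ 2 \<le> 4 * a * c"
    using v a by (simp add: v_def field_simps)
qed


section \<open>Complex conjugation and rational pencils\<close>

lemma field_emb_of_rat: "field_emb (of_rat :: rat \<Rightarrow> 'a::field_char_0)"
  by standard (simp_all add: of_rat_add of_rat_mult)

lemma field_emb_cnj: "field_emb cnj"
  by standard simp_all

lemma field_emb_to_ac: "field_emb to_ac"
  by standard simp_all

lemma of_real_of_rat: "complex_of_real (of_rat r) = of_rat r"
  by (cases r) (simp add: of_rat_rat)

lemma cnj_of_rat: "cnj (of_rat r) = of_rat r"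
  by (simp flip: of_real_of_rat)

lemma map_cnj_of_rat: "map_poly cnj (map_poly of_rat p) = map_poly of_rat p"
  by (rule poly_eqI) (simp add: coeff_map_poly cnj_of_rat)

lemma poly_map_poly_cnj: "poly (map_poly cnj p) (cnj z) = cnj (poly p z)"
  by (rule field_emb.poly_map_emb[OF field_emb_cnj])

lemma no_conjugate_triple_roots:
  fixes A B D :: "rat poly"
  defines "K \<equiv> quartic_I (pencil (coeff A) (coeff B))"
  assumes deg: "degree A = 4" "degree B \<le> 3" and bezout: "a * A + b * B = 1"
    and D_sq: "27 * D ^ 2 = 4 * K ^ 3 - quartic_J (pencil (coeff A) (coeff B)) ^ 2"
    and "K dvd D" "degree D = 3" "degree K = 2"
    and distinct_roots: "coeff K 1 ^ 2 \<noteq> 4 * coeff K 2 * coeff K 0"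
  shows False
proof -
  let ?c = "map_poly (of_rat :: rat \<Rightarrow> complex)"
  interpret emb: field_emb "of_rat :: rat \<Rightarrow> complex"
    by (rule field_emb_of_rat)
  interpret cj: field_emb cnj
    by (rule field_emb_cnj)
  interpret quartic_pencil "?c A" "?c B" "?c D"
    using D_sq unfolding K_def by (intro quartic_pencil_map[OF emb.field_emb_axioms deg bezout])
  have I_eq: "I = ?c K"
    unfolding emb.map_emb_pencil emb.map_emb_quartic_I K_def ..
  have K: "K = [:coeff K 0, coeff K 1, coeff K 2:]"
    using \<open>degree K = 2\<close> by (intro poly_degree_le_2) simp
  have K_poly: "poly K t = coeff K 2 * t ^ 2 + coeff K 1 * t + coeff K 0" for t
    by (subst K) (simp add: power2_eq_square algebra_simps)
  \<comment> \<open>The cube of K is a quarter of \<open>27 D^2 + J^2\<close>, and cubing preserves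
    the sign.\<close>
  have nonneg: "coeff K 2 * t ^ 2 + coeff K 1 * t + coeff K 0 \<ge> 0" for t
  proof -
    have "4 * poly K t ^ 3 = 27 * poly D t ^ 2 + poly (quartic_J (pencil (coeff A) (coeff B))) t ^ 2"
      using arg_cong[OF D_sq, of "\<lambda>p. poly p t"] by simp
    also have "\<dots> \<ge> 0"
      by simp
    finally have "poly K t ^ 3 \<ge> 0"
      by simp
    then show ?thesis
      using K_poly[of t] by (simp add: zero_le_power_eq)
  qed
  have "coeff K 2 \<noteq> 0"
    using \<open>degree K = 2\<close> by (metis degree_0 leading_coeff_0_iff zero_neq_numeral)
  then have disc_K: "coeff K 1 ^ 2 < 4 * coeff K 2 * coeff K 0"
    using nonneg_quadratic_discriminant[OF nonneg] distinct_roots by simp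
  obtain u where u: "poly (?c K) u = 0"
    using alg_closed_imp_poly_has_root[of "?c K"] \<open>degree K = 2\<close> by (auto simp: emb.degree_map_emb)
  have K_nonreal: "poly (?c K) (of_real t) \<noteq> 0" for t
  proof
    assume "poly (?c K) (of_real t) = 0"
    then have "of_real (of_rat (coeff K 2) * t ^ 2 + of_rat (coeff K 1) * t + of_rat (coeff K 0)) = (0::complex)"
      by (subst (asm) K) (simp add: emb.map_emb_pCons power2_eq_square algebra_simps of_real_of_rat)
    then have "of_rat (coeff K 2) * t ^ 2 + of_rat (coeff K 1) * t + of_rat (coeff K 0) = 0"
      by (simp only: of_real_eq_0_iff)
    \<comment> \<open>Completing the square: a real zero would make the negative discriminant of
      \<open>K\<close> a square.\<close>
    then have "(2 * of_rat (coeff K 2) * t + of_rat (coeff K 1)) ^ 2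
        = of_rat (coeff K 1) ^ 2 - 4 * of_rat (coeff K 2) * of_rat (coeff K 0)"
      by Groebner_Basis.algebra
    also have "\<dots> = of_rat (coeff K 1 ^ 2 - 4 * coeff K 2 * coeff K 0)"
      by (simp add: of_rat_diff of_rat_mult of_rat_power)
    also have "\<dots> < 0"
      using disc_K by simp
    finally show False
      by (simp add: not_less[symmetric])
  qed
  then have u_nonreal: "cnj u \<noteq> u"
    using u by (metis Reals_cnj_iff Reals_cases)
  obtain e where e: "D = K * e"
    using \<open>K dvd D\<close> by (elim dvdE)
  have "degree e = 1"
    using \<open>degree D = 3\<close> \<open>degree K = 2\<close> unfolding e
    by (cases "K = 0 \<or> e = 0") (auto simp: degree_mult_eq)
  then have "e = [:coeff e 0, coeff e 1:]" "coeff e 1 \<noteq> 0"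
    using poly_degree_le_2[of e] coeff_eq_0[of e 2] leading_coeff_0_iff[of e] by auto
  \<comment> \<open>The quotient of \<open>D\<close> by \<open>K\<close> is linear over the
    rationals, so the third root of \<open>D\<close> is rational.\<close>
  define t where "t = - coeff e 0 / coeff e 1"
  have "poly e t = 0"
    using \<open>coeff e 1 \<noteq> 0\<close> by (subst \<open>e = _\<close>) (simp add: t_def)
  then have "poly D t = 0"
    by (simp add: e)
  then have Dt: "poly (?c D) (of_rat t) = 0"
    by (simp add: emb.poly_map_emb)
  moreover have "poly I (of_rat t) \<noteq> 0"
    using K_nonreal[of "of_rat t"] unfolding I_eq of_real_of_rat .
  ultimately obtain q where q: "degree q \<le> 2" "F (of_rat t) = q ^ 2"
    using at_root(2) by blast
  have "u \<noteq> 0"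
    using u_nonreal by auto
  have D_u: "poly (?c D) u = 0"
    unfolding e emb.map_emb_mult using u by simp
  obtain x a b where triple: "F u = [:- x, 1:] ^ 3 * [:b, a:]"
    using triple_root[OF D_u _ \<open>u \<noteq> 0\<close>] u unfolding I_eq by blast
  have "map_poly cnj (F u) = F (cnj u)"
    by (simp add: cj.map_emb_diff cj.map_emb_smult map_cnj_of_rat)
  then have triple': "F (cnj u) = [:- cnj x, 1:] ^ 3 * [:cnj b, cnj a:]"
    unfolding triple by (simp add: cj.map_emb_mult cj.map_emb_power cj.map_emb_pCons
        del: mult_pCons_left mult_pCons_right)
  have "poly (F u) x = 0"
    by (simp add: triple)
  then have ux: "u * poly (?c A) x = poly (?c B) x"
    by simp
  \<comment> \<open>The parameter \<open>u\<close> is the value of B / A at \<open>x\<close>; a real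
    \<open>x\<close> would make it real.\<close>
  have "cnj x \<noteq> x"
  proof
    assume "cnj x = x"
    then have real: "cnj (poly (?c p) x) = poly (?c p) x" for p
      using poly_map_poly_cnj[of "?c p" x] by (simp add: map_cnj_of_rat)
    have "cnj u * poly (?c A) x = poly (?c B) x"
      using arg_cong[OF ux, of cnj] by (simp add: real)
    then have "(cnj u - u) * poly (?c A) x = 0"
      using ux by (simp add: algebra_simps)
    then show False
      using u_nonreal ux no_common_root[of x] by auto
  qed
  define \<Lambda> where "\<Lambda> = apolar_form x (cnj x)"
  \<comment> \<open>The pairing is affine in the parameter. Having two distinct zeros,
    \<open>u\<close> and its conjugate, it vanishes on every member, in particular at
    \<open>t\<close>.\<close>
  have \<Lambda>_F: "\<Lambda> (coeff (F v)) = v * \<Lambda> (coeff (?c A)) - \<Lambda> (coeff (?c B))" for v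
    by (simp add: \<Lambda>_def apolar_form_def algebra_simps)
  have "\<Lambda> (coeff (F u)) = 0" "\<Lambda> (coeff (F (cnj u))) = 0"
    unfolding triple triple' \<Lambda>_def by (rule apolar_form_triple)+
  then have "(cnj u - u) * \<Lambda> (coeff (?c A)) = 0" "\<Lambda> (coeff (?c B)) = u * \<Lambda> (coeff (?c A))"
    unfolding \<Lambda>_F by (simp_all add: algebra_simps)
  then have "\<Lambda> (coeff (F (of_rat t))) = 0"
    unfolding \<Lambda>_F using u_nonreal by auto
  define q0 q1 q2 where "q0 = coeff q 0" and "q1 = coeff q 1" and "q2 = coeff q 2"
  have q_eq: "q = [:q0, q1, q2:]"
    unfolding q0_def q1_def q2_def using q(1) by (rule poly_degree_le_2)
  define w where "w = q1 * (x + cnj x) + 2 * q0 + 2 * q2 * (x * cnj x)"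
  have zero: "w ^ 2 + 2 * poly q x * poly q (cnj x) = 0"
    using \<open>\<Lambda> (coeff (F (of_rat t))) = 0\<close> unfolding q(2) \<Lambda>_def w_def q_eq
    by (simp only: apolar_form_square)
  have "map_poly cnj (F (of_rat t)) = F (of_rat t)"
    by (simp add: cj.map_emb_diff cj.map_emb_smult map_cnj_of_rat cnj_of_rat)
  \<comment> \<open>The member at \<open>t\<close> is real, but its square root may be real or
    purely imaginary; \<epsilon> treats both cases together.\<close>
  then have "map_poly cnj q ^ 2 = q ^ 2"
    unfolding q(2) cj.map_emb_power .
  then have "(map_poly cnj q - q) * (map_poly cnj q + q) = 0"
    by (simp add: algebra_simps power2_eq_square)
  then consider "map_poly cnj q = q" | "map_poly cnj q = - q"
    by (auto simp: eq_neg_iff_add_eq_0)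
  then obtain \<epsilon> :: complex where \<epsilon>: "\<epsilon> \<noteq> 0" "map_poly cnj q = smult \<epsilon> q"
    by cases (use that[of 1] that[of "- 1"] in auto)
  have "cnj q0 = \<epsilon> * q0" "cnj q1 = \<epsilon> * q1" "cnj q2 = \<epsilon> * q2"
    using \<epsilon>(2) by (simp_all add: q_eq cj.map_emb_pCons)
  then have w_cnj: "cnj w = \<epsilon> * w"
    by (simp add: w_def algebra_simps)
  have q_cnj: "cnj (poly q x) = \<epsilon> * poly q (cnj x)"
    using poly_map_poly_cnj[of q x] \<epsilon>(2) by simp
  \<comment> \<open>Multiplication by \<epsilon> turns the vanishing pairing into a sum of squared
    moduli.\<close>
  have "w * cnj w + 2 * (poly q x * cnj (poly q x)) = \<epsilon> * (w ^ 2 + 2 * poly q x * poly q (cnj x))"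
    unfolding w_cnj q_cnj by (simp add: power2_eq_square algebra_simps)
  also have "\<dots> = 0"
    unfolding zero by simp
  also have "w * cnj w + 2 * (poly q x * cnj (poly q x)) = of_real (norm w ^ 2 + 2 * norm (poly q x) ^ 2)"
    by (simp only: of_real_add of_real_mult of_real_numeral complex_norm_square)
  finally have "norm w ^ 2 + 2 * norm (poly q x) ^ 2 = 0"
    by (simp only: of_real_eq_0_iff)
  then have "norm w ^ 2 = 0" "norm (poly q x) ^ 2 = 0"
    using zero_le_power2[of "norm w"] zero_le_power2[of "norm (poly q x)"] by linarith+
  then have "w = 0" "poly q x = 0"
    by simp_all
  moreover from this have "poly q (cnj x) = 0"
    using q_cnj \<epsilon>(1) by simp
  ultimately have eqs: "w = 0" "q0 + x * q1 + x ^ 2 * q2 = 0" "q0 + cnj x * q1 + cnj x ^ 2 * q2 = 0"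
    by (simp_all add: q_eq power2_eq_square algebra_simps)
  \<comment> \<open>As \<open>q\<close> vanishes at \<open>x\<close> and its conjugate, it equals
    \<open>q2\<close> times the quadratic with these roots. Then
    \<open>w = - (cnj x - x)^2 * q2\<close>, so \<open>q2\<close> is zero too.\<close>
  have "(cnj x - x) * (q1 + (x + cnj x) * q2) = 0"
    using eqs(2,3) by Groebner_Basis.algebra
  then have q1: "q1 = - ((x + cnj x) * q2)"
    using \<open>cnj x \<noteq> x\<close> by (simp add: add_eq_0_iff2)
  then have q0: "q0 = x * cnj x * q2"
    using eqs(2) by Groebner_Basis.algebra
  have "(cnj x - x) ^ 2 * q2 = 0"
    using eqs(1) unfolding w_def q0 q1 by Groebner_Basis.algebra
  then have "q2 = 0"
    using \<open>cnj x \<noteq> x\<close> by simp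
  then have "q = 0"
    using q0 q1 by (simp add: q_eq)
  then show False
    using F_nonzero[of "of_rat t"] q(2) by simp
qed

section \<open>Alternating lines\<close>

lemma card_eq_4_obtain:
  assumes "card S = 4" "x \<in> S"
  obtains r2 r3 r4 where "S = {x, r2, r3, r4}" "distinct [x, r2, r3, r4]"
proof -
  have "card (S - {x}) = 3"
    using assms by simp
  then obtain a b c where abc: "S - {x} = {a, b, c}" "a \<noteq> b" "b \<noteq> c" "a \<noteq> c"
    by (auto simp: card_3_iff)
  then have "S = {x, a, b, c}" "x \<notin> {a, b, c}"
    using assms(2) by auto
  then show thesis
    using abc by (intro that[of a b c]) auto
qed

lemma coeff_poly_line: "coeff (poly_line P Q) i = to_fract [:coeff P i, - coeff Q i:]"
proof -
  have "coeff (poly_line P Q) i = to_fract ([:coeff P i:] - [:0, 1:] * [:coeff Q i:])"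
    unfolding poly_line_def by (simp only: coeff_diff coeff_smult coeff_map_poly to_fract_0 pCons_0_0
        to_fract_diff to_fract_mult)
  then show ?thesis
    by simp
qed

lemma field_emb_const: "field_emb (\<lambda>c. to_fract [:c:])"
  by standard (simp_all flip: to_fract_add to_fract_mult one_pCons)

lemma field_emb_to_ac_const: "field_emb (\<lambda>c. to_ac (to_fract [:c:]))"
proof -
  interpret field_emb "\<lambda>c::'a. to_fract [:c:]"
    by (rule field_emb_const)
  show ?thesis
    by standard (simp_all add: emb_simps)
qed

lemma map_to_ac_const: "map_poly to_ac (map_poly (\<lambda>c. to_fract [:c:]) p) = map_poly (\<lambda>c. to_ac (to_fract [:c:])) p"
  by (rule poly_eqI) (simp add: coeff_map_poly)

lemma ac_roots_poly_line:
  "r \<in> ac_roots (poly_line P Q) \<longleftrightarrow> poly (map_poly (\<lambda>c. to_ac (to_fract [:c:])) P) r =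
     to_ac (to_fract [:0, 1:]) * poly (map_poly (\<lambda>c. to_ac (to_fract [:c:])) Q) r"
proof -
  interpret field_emb to_ac
    by (rule field_emb_to_ac)
  show ?thesis
    by (simp add: ac_roots_def poly_line_def map_emb_diff map_emb_smult map_to_ac_const)
qed

text \<open>A common root would be a constant root of the line, fixed by all automorphisms, whereas
  the alternating group moves every root.\<close>

lemma alternating_line_no_common_root:
  assumes alt: "has_alternating_galois_group 4 (poly_line P Q)" and "poly P x = 0"
  shows "poly Q x \<noteq> 0"
proof
  define \<iota> where "\<iota> = (\<lambda>c::'a. to_ac (to_fract [:c:]))"
  interpret e: field_emb \<iota>
    unfolding \<iota>_def by (rule field_emb_to_ac_const)
  assume "poly Q x = 0"
  with \<open>poly P x = 0\<close> have "\<iota> x \<in> ac_roots (poly_line P Q)"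
    unfolding ac_roots_poly_line \<iota>_def[symmetric] by (simp add: e.poly_map_emb)
  moreover have "card (ac_roots (poly_line P Q)) = 4"
    using alt by (simp add: has_alternating_galois_group_def)
  ultimately obtain r2 r3 r4 where r: "ac_roots (poly_line P Q) = {\<iota> x, r2, r3, r4}"
    "distinct [\<iota> x, r2, r3, r4]"
    by (metis card_eq_4_obtain)
  obtain \<sigma> where \<sigma>: "\<sigma> \<in> splitting_field_automorphisms (poly_line P Q)" "\<sigma> (\<iota> x) = r2"
    using alternating_three_cycle[OF alt r] by metis
  have "\<sigma> (\<iota> x) = \<iota> x"
    using \<sigma>(1) by (simp add: splitting_field_automorphisms_def \<iota>_def)
  then show False
    using \<sigma>(2) r(2) by auto
qed

text \<open>A quotient \<open>q\<^sub>1 / q\<^sub>2\<close> of square roots of two members of the line takes at most two values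
  \<open>\<plusminus>s\<close> on the four roots. A 3-cycle fixing one root fixes \<open>s\<close>, so the quotient is constant on the
  other three roots, and then everywhere.\<close>

lemma alternating_line_two_squares:
  fixes P Q q1 q2 :: "'a::field poly"
  assumes alt: "has_alternating_galois_group 4 (poly_line P Q)"
    and P: "degree P = 4" and Q: "degree Q \<le> 3" "Q \<noteq> 0" and bezout: "a * P + b * Q = 1"
    and q: "degree q1 \<le> 2" "degree q2 \<le> 2"
    and sq1: "smult \<alpha> P - smult \<beta> Q = q1 ^ 2" and sq2: "smult \<gamma> P - smult \<delta> Q = q2 ^ 2"
  shows "\<alpha> * \<delta> = \<beta> * \<gamma>"
proof (rule ccontr)
  assume neq: "\<alpha> * \<delta> \<noteq> \<beta> * \<gamma>"
  define \<kappa> where "\<kappa> = (\<lambda>c::'a. to_fract [:c:])"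
  define \<iota> where "\<iota> = (\<lambda>c::'a. to_ac (\<kappa> c))"
  define T :: "'a poly fract alg_closure" where "T = to_ac (to_fract [:0, 1:])"
  interpret e: field_emb \<iota>
    unfolding \<iota>_def \<kappa>_def by (rule field_emb_to_ac_const)
  let ?m = "map_poly \<iota>"
  have m_eq: "?m p = map_poly to_ac (map_poly \<kappa> p)" for p
    unfolding \<iota>_def \<kappa>_def map_to_ac_const ..
  define f where "f = poly_line P Q"
  have root: "poly (?m P) r = T * poly (?m Q) r" if "r \<in> ac_roots f" for r
    using that unfolding f_def ac_roots_poly_line \<iota>_def \<kappa>_def T_def .
  have Q_nz: "poly (?m Q) r \<noteq> 0" if "r \<in> ac_roots f" for r
    using root[OF that] e.no_common_root[OF bezout, of r] by auto
  have T_nz: "\<iota> x * T - \<iota> y \<noteq> 0" if "x \<noteq> 0 \<or> y \<noteq> 0" for x y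
  proof -
    have "\<iota> x * T - \<iota> y = to_ac (to_fract ([:x:] * [:0, 1:] - [:y:]))"
      unfolding \<iota>_def \<kappa>_def T_def by (simp only: to_ac_diff to_ac_mult to_fract_diff to_fract_mult)
    then show ?thesis
      using that by auto
  qed
  \<comment> \<open>On the roots of the line P = T Q, so each member becomes a multiple of Q by a
    factor independent of the root. Hence the square of \<open>s r\<close> does not depend on
    \<open>r\<close>.\<close>
  have value_sq: "poly (?m p) r ^ 2 = (\<iota> x * T - \<iota> y) * poly (?m Q) r"
    if "smult x P - smult y Q = p ^ 2" "r \<in> ac_roots f" for x y p r
  proof -
    have "poly (?m p) r ^ 2 = poly (?m (smult x P - smult y Q)) r"
      by (simp add: that(1) e.map_emb_power)
    also have "\<dots> = (\<iota> x * T - \<iota> y) * poly (?m Q) r"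
      using root[OF that(2)] by (simp add: e.map_emb_diff e.map_emb_smult algebra_simps)
    finally show ?thesis .
  qed
  define s where "s r = poly (?m q1) r / poly (?m q2) r" for r
  have "\<iota> \<gamma> * T - \<iota> \<delta> \<noteq> 0"
    using neq by (intro T_nz) auto
  then have q2_nz: "poly (?m q2) r \<noteq> 0" if "r \<in> ac_roots f" for r
    using value_sq[OF sq2 that] Q_nz[OF that] by auto
  have s_sq: "s r ^ 2 = (\<iota> \<alpha> * T - \<iota> \<beta>) / (\<iota> \<gamma> * T - \<iota> \<delta>)" if "r \<in> ac_roots f" for r
    using value_sq[OF sq1 that] value_sq[OF sq2 that] Q_nz[OF that]
    by (simp add: s_def power_divide)
  have "card (ac_roots f) = 4"
    using alt by (simp add: has_alternating_galois_group_def f_def)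
  moreover from this obtain r1 where "r1 \<in> ac_roots f"
    by (metis card.empty equals0I zero_neq_numeral)
  ultimately obtain r2 r3 r4 where r: "ac_roots f = {r1, r2, r3, r4}" "distinct [r1, r2, r3, r4]"
    by (metis card_eq_4_obtain)
  obtain \<sigma> where \<sigma>: "\<sigma> \<in> splitting_field_automorphisms f" "\<sigma> r1 = r2" "\<sigma> r2 = r3" "\<sigma> r4 = r4"
    using alternating_three_cycle[OF alt[folded f_def] r] by metis
  interpret base_hom "carrier (splitting_field f)" \<sigma>
    using automorphism_base_hom[OF \<sigma>(1)] .
  have in_L: "r \<in> carrier (splitting_field f)" "poly (?m p) r \<in> carrier (splitting_field f)"
    if "r \<in> ac_roots f" for r p
    using root_in_splitting_field[OF that] unfolding m_eq by (auto intro: poly_closed simp del: splitting_field_sel)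
  have s_in_L: "s r \<in> carrier (splitting_field f)" if "r \<in> ac_roots f" for r
    unfolding s_def divide_inverse using in_L[OF that] by (intro mult_closed inverse_closed)
  have \<sigma>_s: "\<sigma> (s r) = s (\<sigma> r)" if "r \<in> ac_roots f" "\<sigma> r \<in> ac_roots f" for r
  proof -
    have "\<sigma> (s r * poly (?m q2) r) = \<sigma> (poly (?m q1) r)"
      using q2_nz[OF that(1)] by (simp add: s_def)
    then have "\<sigma> (s r) * poly (?m q2) (\<sigma> r) = poly (?m q1) (\<sigma> r)"
      unfolding hom_mult[OF s_in_L[OF that(1)] in_L(2)[OF that(1)]]
      unfolding m_eq hom_poly_base[OF in_L(1)[OF that(1)]] .
    then show ?thesis
      using q2_nz[OF that(2)] by (simp add: s_def field_simps)
  qed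
  have roots: "r1 \<in> ac_roots f" "r2 \<in> ac_roots f" "r3 \<in> ac_roots f" "r4 \<in> ac_roots f"
    using r(1) by auto
  have fixed: "\<sigma> (s r4) = s r4"
    using \<sigma>_s[OF roots(4)] \<sigma>(4) roots by simp
  have "s r1 ^ 2 = s r4 ^ 2"
    using s_sq roots by simp
  then have "s r1 = s r4 \<or> s r1 = - s r4"
    by (simp add: power2_eq_iff)
  then have "\<sigma> (s r1) = s r1"
    using fixed s_in_L[OF roots(4)] by auto
  then have "s r2 = s r1"
    using \<sigma>_s[OF roots(1)] \<sigma>(2) roots by simp
  moreover from this have "s r3 = s r1"
    using \<sigma>_s[OF roots(2)] \<sigma>(3) roots \<open>\<sigma> (s r1) = s r1\<close> by simp
  ultimately have s_const: "s r = s r1" if "r \<in> {r1, r2, r3}" for r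
    using that by auto
  \<comment> \<open>Two polynomials of degree at most 2 that agree at three distinct points are
    equal.\<close>
  have q12: "?m q1 = smult (s r1) (?m q2)"
  proof (rule poly_eqI_degree[of "{r1, r2, r3}"])
    fix r assume "r \<in> {r1, r2, r3}"
    then show "poly (?m q1) r = poly (smult (s r1) (?m q2)) r"
      using s_const[of r] q2_nz[of r] roots by (auto simp: s_def field_simps)
  qed (use r(2) q in \<open>auto simp: e.degree_map_emb intro!: le_less_trans[OF degree_smult_le]\<close>)
  define c where "c = s r1 ^ 2"
  have "?m (smult \<alpha> P - smult \<beta> Q) = smult c (?m (smult \<gamma> P - smult \<delta> Q))"
    unfolding sq1 sq2 e.map_emb_power q12 c_def by (simp add: smult_power)
  then have eq: "smult (\<iota> \<alpha> - c * \<iota> \<gamma>) (?m P) = smult (\<iota> \<beta> - c * \<iota> \<delta>) (?m Q)"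
    by (simp add: e.map_emb_diff e.map_emb_smult algebra_simps smult_diff_left smult_diff_right)
  have "coeff P 4 \<noteq> 0" "coeff Q 4 = 0"
    using P Q leading_coeff_0_iff[of P] coeff_eq_0[of Q 4] by auto
  then have \<alpha>: "\<iota> \<alpha> = c * \<iota> \<gamma>"
    using arg_cong[OF eq, of "\<lambda>p. coeff p 4"] by (simp add: e.coeff_map_emb)
  then have "smult (\<iota> \<beta> - c * \<iota> \<delta>) (?m Q) = 0"
    using eq by simp
  then have \<beta>: "\<iota> \<beta> = c * \<iota> \<delta>"
    using Q(2) e.map_emb_eq_iff[of Q 0] by simp
  have "\<iota> (\<alpha> * \<delta>) = \<iota> (\<beta> * \<gamma>)"
    by (simp add: e.emb_mult \<alpha> \<beta>)
  then show False
    using neq by (simp add: e.emb_eq_iff)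
qed


section \<open>The discriminant of the line over the rational function field\<close>

lemma to_fract_numeral: "to_fract (numeral n) = numeral n"
proof -
  have "to_fract (of_nat k) = of_nat k" for k
    by (induction k) auto
  from this[of "numeral n"] show ?thesis
    by simp
qed

lemma quartic_to_fract:
  fixes f :: "nat \<Rightarrow> 'a::idom"
  shows "quartic_I (\<lambda>i. to_fract (f i)) = to_fract (quartic_I f)"
    "quartic_J (\<lambda>i. to_fract (f i)) = to_fract (quartic_J f)"
  by (simp_all add: quartic_I_def quartic_J_def to_fract_numeral power2_eq_square power3_eq_cube)

text \<open>Since 27 is a unit, the denominator \<open>q\<close> satisfies
  \<open>q ^ 2 dvd p ^ 2\<close>, so it divides the numerator.\<close>

lemma to_fract_square:
  fixes D :: "rat poly"
  assumes "to_fract D = 27 * k ^ 2"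
  obtains d where "D = 27 * d ^ 2" "k = to_fract d"
proof -
  obtain p q where pq: "k = Fract p q" "q \<noteq> 0"
    by (cases k) auto
  have "to_fract (D * q ^ 2) = to_fract (27 * p ^ 2)"
    using pq(2) unfolding to_fract_mult assms pq(1) Fract_conv_to_fract
    by (simp add: power2_eq_square to_fract_numeral)
  then have eq: "D * q ^ 2 = 27 * p ^ 2"
    by (simp only: to_fract_eq_iff)
  have "q ^ 2 dvd [:1/27:] * (D * q ^ 2)"
    by (intro dvd_mult dvd_refl)
  also have "\<dots> = p ^ 2"
    unfolding eq by (simp add: numeral_poly)
  finally have "q dvd p"
    by simp
  then obtain d where "p = q * d"
    by (elim dvdE)
  then have "k = to_fract d"
    using pq by (simp add: Fract_conv_to_fract)
  moreover have "D = 27 * d ^ 2"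
    using eq \<open>p = q * d\<close> pq(2) by (simp add: power_mult_distrib)
  ultimately show thesis
    using that by blast
qed

lemma degree_quartic_I_pencil: "degree (quartic_I (pencil g b)) \<le> 2"
  by (simp add: quartic_I_def pencil_def numeral_poly power2_eq_square degree_pCons_eq_if)

lemma degree_quartic_J_pencil: "degree (quartic_J (pencil g b)) \<le> 3"
  by (simp add: quartic_J_def pencil_def numeral_poly power2_eq_square power3_eq_cube degree_pCons_eq_if)


lemma quartic_scale:
  "quartic_I (\<lambda>i. u * f i) = u ^ 2 * quartic_I f" "quartic_J (\<lambda>i. u * f i) = u ^ 3 * quartic_J f"
  by (simp_all add: quartic_I_def quartic_J_def power2_eq_square power3_eq_cube algebra_simps)

lemma monic_quartic_split:
  fixes f :: "'a::idom poly"
  assumes "degree f = 4" "lead_coeff f = 1" and roots: "\<And>x. x \<in> {r1, r2, r3, r4} \<Longrightarrow> poly f x = 0"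
    and "distinct [r1, r2, r3, r4]"
  shows "f = [:- r1, 1:] * [:- r2, 1:] * [:- r3, 1:] * [:- r4, 1:]"
proof (rule poly_eqI_degree_lead_coeff[of _ 4 _ "{r1, r2, r3, r4}"])
  show "degree f \<le> 4"
    using assms(1) by simp
  show "coeff f 4 = coeff ([:- r1, 1:] * [:- r2, 1:] * [:- r3, 1:] * [:- r4, 1:]) 4"
    using assms(1,2) by (simp add: numeral_eq_Suc)
  show "4 \<le> card {r1, r2, r3, r4}"
    using assms(4) by simp
  show "degree ([:- r1, 1:] * [:- r2, 1:] * [:- r3, 1:] * [:- r4, 1:]) \<le> 4"
    by (simp add: degree_mult_eq del: mult_pCons_left mult_pCons_right)
  show "poly f z = poly ([:- r1, 1:] * [:- r2, 1:] * [:- r3, 1:] * [:- r4, 1:]) z"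
    if "z \<in> {r1, r2, r3, r4}" for z
    using roots[OF that] that by (auto simp del: mult_pCons_left mult_pCons_right)
qed

text \<open>The signs make the pencil equal to P - T Q with parameter T. Its discriminant is the
  square of the Vandermonde product, which lies in the base field for an alternating group and is
  nonzero because the roots are distinct.\<close>

lemma alternating_line_discriminant:
  fixes P Q :: "rat poly"
  defines "p \<equiv> pencil (coeff (- Q)) (coeff (- P))"
  assumes alt: "has_alternating_galois_group 4 (poly_line P Q)"
    and P: "lead_coeff P = 1" "degree P = 4" and Q: "degree Q \<le> 3"
  obtains d where "4 * quartic_I p ^ 3 - quartic_J p ^ 2 = 27 * d ^ 2" "d \<noteq> 0"
proof -
  define f where "f = poly_line P Q"
  interpret e: field_emb "to_ac :: rat poly fract \<Rightarrow> _"
    by (rule field_emb_to_ac)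
  have coeff_f: "coeff f = (\<lambda>i. to_fract (p i))"
    unfolding f_def p_def by (auto simp: coeff_poly_line pencil_def)
  have "coeff f 4 = 1"
    using P Q by (simp add: coeff_f p_def pencil_def coeff_eq_0 flip: one_pCons)
  moreover have "coeff f i = 0" if "i > 4" for i
    using that P Q by (simp add: coeff_f p_def pencil_def coeff_eq_0)
  ultimately have f: "degree f = 4" "lead_coeff f = 1" "f \<noteq> 0"
    by (metis degree_le le_antisym le_degree not_le zero_neq_one,
        metis degree_le le_antisym le_degree not_le zero_neq_one, auto)
  have "card (ac_roots f) = 4"
    using alt by (simp add: has_alternating_galois_group_def f_def)
  moreover from this obtain r1 where "r1 \<in> ac_roots f"
    by (metis card.empty equals0I zero_neq_numeral)
  ultimately obtain r2 r3 r4 where r: "ac_roots f = {r1, r2, r3, r4}" "distinct [r1, r2, r3, r4]"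
    by (metis card_eq_4_obtain)
  have "map_poly to_ac f = [:- r1, 1:] * [:- r2, 1:] * [:- r3, 1:] * [:- r4, 1:]"
    using f r(1) by (intro monic_quartic_split[OF _ _ _ r(2)])
      (auto simp: e.degree_map_emb e.coeff_map_emb ac_roots_def)
  then have "27 * vandermonde4 r1 r2 r3 r4 ^ 2 =
      4 * quartic_I (coeff (map_poly to_ac f)) ^ 3 - quartic_J (coeff (map_poly to_ac f)) ^ 2"
    using quartic_linear_factors[of 1 r1 r2 r3 r4] by simp
  also have "\<dots> = to_ac (4 * quartic_I (coeff f) ^ 3 - quartic_J (coeff f) ^ 2)"
    unfolding quartic_I_def quartic_J_def e.coeff_map_emb by (simp add: e.emb_simps)
  also have "4 * quartic_I (coeff f) ^ 3 - quartic_J (coeff f) ^ 2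
      = to_fract (4 * quartic_I p ^ 3 - quartic_J p ^ 2)"
    unfolding coeff_f quartic_to_fract by (simp add: to_fract_numeral power2_eq_square power3_eq_cube)
  finally have vand: "27 * vandermonde4 r1 r2 r3 r4 ^ 2 =
      to_ac (to_fract (4 * quartic_I p ^ 3 - quartic_J p ^ 2))" .
  then have "vandermonde4 r1 r2 r3 r4 ^ 2 = to_ac (to_fract (4 * quartic_I p ^ 3 - quartic_J p ^ 2) / 27)"
    by (simp add: e.emb_numeral field_simps)
  from vandermonde_in_base[OF alt[folded f_def] f(3) r this]
  have "vandermonde4 r1 r2 r3 r4 \<in> range to_ac" .
  then obtain k where k: "vandermonde4 r1 r2 r3 r4 = to_ac k"
    by blast
  have "to_ac (to_fract (4 * quartic_I p ^ 3 - quartic_J p ^ 2)) = to_ac (27 * k ^ 2)"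
    using vand by (simp add: k)
  then have "to_fract (4 * quartic_I p ^ 3 - quartic_J p ^ 2) = 27 * k ^ 2"
    by (simp only: to_ac_eq_iff)
  then obtain d where d: "4 * quartic_I p ^ 3 - quartic_J p ^ 2 = 27 * d ^ 2" "k = to_fract d"
    by (rule to_fract_square)
  have "vandermonde4 r1 r2 r3 r4 \<noteq> 0"
    using r(2) by (auto simp: vandermonde4_def)
  then have "d \<noteq> 0"
    using k d(2) by auto
  with d(1) show thesis
    by (rule that)
qed

text \<open>With \<open>U = 1 / (T - t)\<close> the line \<open>P - T Q\<close> becomes \<open>U (P - t Q) - Q\<close> up to a scalar, and for \<open>t\<close> off the
  branch locus the point \<open>U = \<infinity>\<close> is unramified.\<close>

lemma unramified_pencil:
  fixes P Q d :: "'a::field_char_0 poly"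
  defines "p \<equiv> pencil (coeff (- Q)) (coeff (- P))"
  assumes d: "4 * quartic_I p ^ 3 - quartic_J p ^ 2 = 27 * d ^ 2" and t: "poly d t \<noteq> 0"
  defines "A \<equiv> P - smult t Q"
  obtains D where "27 * D ^ 2 = 4 * quartic_I (pencil (coeff A) (coeff Q)) ^ 3
      - quartic_J (pencil (coeff A) (coeff Q)) ^ 2" "degree D = 3"
proof -
  define e where "e = pcompose d [:t, 1:]"
  \<comment> \<open>The reversal of \<open>e\<close> as a cubic, that is u^3 d(t + 1/u); its leading
    coefficient is d(t), which is nonzero.\<close>
  define D where "D = [:coeff e 3, coeff e 2, coeff e 1, coeff e 0:]"
  have "degree (27 * d ^ 2) \<le> 6"
  proof -
    have "degree (4 * quartic_I p ^ 3) \<le> 6"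
      using degree_power_le[of "quartic_I p" 3] degree_quartic_I_pencil[of "coeff (- Q)" "coeff (- P)"]
      by (simp add: p_def numeral_poly)
    moreover have "degree (quartic_J p ^ 2) \<le> 6"
      using degree_power_le[of "quartic_J p" 2] degree_quartic_J_pencil[of "coeff (- Q)" "coeff (- P)"]
      by (simp add: p_def)
    ultimately show ?thesis
      unfolding d[symmetric] by (rule degree_diff_le)
  qed
  moreover have "d \<noteq> 0"
    using t by auto
  ultimately have "degree d \<le> 3"
    by (simp add: numeral_poly degree_power_eq)
  then have e: "degree e \<le> 3"
    by (simp add: e_def degree_pcompose)
  have e_poly: "poly e x = coeff e 0 + coeff e 1 * x + coeff e 2 * x ^ 2 + coeff e 3 * x ^ 3" for x
  proof -
    have "poly e x = (\<Sum>i\<le>3. coeff e i * x ^ i)"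
      unfolding poly_altdef using e by (intro sum.mono_neutral_left) (auto simp: coeff_eq_0)
    then show ?thesis
      by (simp add: numeral_eq_Suc)
  qed
  define R where "R = 4 * quartic_I (pencil (coeff A) (coeff Q)) ^ 3 - quartic_J (pencil (coeff A) (coeff Q)) ^ 2"
  have "poly (27 * D ^ 2) u = poly R u" if "u \<noteq> 0" for u
  proof -
    \<comment> \<open>With this choice u (P - v Q) = u A - Q.\<close>
    define v where "v = t + 1 / u"
    have "poly D u = u ^ 3 * poly e (1 / u)"
      using that unfolding e_poly D_def
      by (simp add: field_simps power2_eq_square power3_eq_cube)
    also have "poly e (1 / u) = poly d v"
      by (simp add: e_def poly_pcompose v_def)
    finally have "poly (27 * D ^ 2) u = u ^ 6 * poly (27 * d ^ 2) v"
      by (simp add: power_mult_distrib flip: power_mult)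
    also have "\<dots> = u ^ 6 * (4 * quartic_I (\<lambda>i. coeff P i - v * coeff Q i) ^ 3
        - quartic_J (\<lambda>i. coeff P i - v * coeff Q i) ^ 2)"
      unfolding d[symmetric] p_def by (simp add: poly_pencil_invariants(1,2))
    also have "\<dots> = 4 * quartic_I (\<lambda>i. u * (coeff P i - v * coeff Q i)) ^ 3
        - quartic_J (\<lambda>i. u * (coeff P i - v * coeff Q i)) ^ 2"
      unfolding quartic_scale by (simp add: power_mult_distrib algebra_simps flip: power_mult)
    also have "(\<lambda>i. u * (coeff P i - v * coeff Q i)) = (\<lambda>i. u * coeff A i - coeff Q i)"
      using that by (auto simp: A_def v_def field_simps)
    also have "4 * quartic_I (\<lambda>i. u * coeff A i - coeff Q i) ^ 3
        - quartic_J (\<lambda>i. u * coeff A i - coeff Q i) ^ 2 = poly R u"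
      by (simp add: R_def poly_pencil_invariants(1,2))
    finally show ?thesis .
  qed
  \<comment> \<open>The extra factor extends the equality to the excluded point
    \<open>u = 0\<close>.\<close>
  then have "poly ([:0, 1:] * (27 * D ^ 2)) u = poly ([:0, 1:] * R) u" for u
    by (cases "u = 0") auto
  then have "[:0, 1:] * (27 * D ^ 2) = [:0, 1:] * R"
    by (simp only: poly_eq_poly_eq_iff[symmetric]) auto
  then have "27 * D ^ 2 = R"
    by (metis mult_left_cancel pCons_eq_0_iff zero_neq_one)
  moreover have "coeff e 0 \<noteq> 0"
    using t by (simp add: e_def flip: poly_0_coeff_0) (simp add: poly_pcompose)
  then have "degree D = 3"
    by (simp add: D_def)
  ultimately show thesis
    unfolding R_def by (rule that)
qed

text \<open>A nonconstant gcd would have a root in the algebraic closure, and this root would be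
  common to both polynomials.\<close>

lemma bezout_if_no_common_root:
  fixes P Q :: "rat poly"
  assumes "\<And>x. poly (map_poly to_ac P) x = 0 \<Longrightarrow> poly (map_poly to_ac Q) x \<noteq> 0"
  obtains a b where "a * P + b * Q = 1"
proof -
  interpret field_emb "to_ac :: rat \<Rightarrow> _"
    by (rule field_emb_to_ac)
  define g where "g = gcd P Q"
  have root: "poly (map_poly to_ac g) x \<noteq> 0" for x
  proof
    assume "poly (map_poly to_ac g) x = 0"
    moreover obtain p q where "P = g * p" "Q = g * q"
      unfolding g_def by (meson dvdE gcd_dvd1 gcd_dvd2)
    ultimately have "poly (map_poly to_ac P) x = 0" "poly (map_poly to_ac Q) x = 0"
      by (simp_all add: map_emb_mult)
    then show False
      using assms by blast
  qed
  then have "degree g = 0"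
    using alg_closed_imp_poly_has_root[of "map_poly to_ac g"] by (auto simp: degree_map_emb)
  moreover have "g \<noteq> 0"
    using root[of 0] by auto
  ultimately have "is_unit g"
    by (simp add: is_unit_iff_degree)
  then have "gcd P Q = 1"
    unfolding g_def by (simp add: is_unit_gcd flip: coprime_iff_gcd_eq_1)
  then show thesis
    using that bezout_coefficients_fst_snd[of P Q] by metis
qed

lemma poly_with_two_roots:
  fixes p :: "'a::field poly"
  assumes "poly p x = 0" "poly p y = 0" "x \<noteq> y"
  shows "[:- x, 1:] * [:- y, 1:] dvd p"
proof -
  obtain g where g: "p = [:- x, 1:] * g"
    using assms(1) by (auto simp: poly_eq_0_iff_dvd)
  then have "poly g y = 0"
    using assms by auto
  then have "[:- y, 1:] dvd g"
    by (simp add: poly_eq_0_iff_dvd)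
  then show ?thesis
    unfolding g by (rule mult_dvd_mono[OF dvd_refl])
qed

text \<open>Division with remainder is compatible with the embedding, and the embedded remainder is
  too small in degree to be a nonzero multiple.\<close>

lemma (in field_emb) map_emb_dvdD:
  assumes "map_poly \<iota> p dvd map_poly \<iota> q" "p \<noteq> 0"
  shows "p dvd q"
proof -
  define r where "r = q mod p"
  have "q = p * (q div p) + r"
    by (simp add: r_def)
  then have "map_poly \<iota> q = map_poly \<iota> p * map_poly \<iota> (q div p) + map_poly \<iota> r"
    by (metis map_emb_add map_emb_mult)
  then have "map_poly \<iota> p dvd map_poly \<iota> r"
    using assms(1) by (metis dvd_add_right_iff dvd_triv_left)
  moreover have "r = 0 \<or> degree r < degree p"
    using degree_mod_less[of p q] assms(2) by (auto simp: r_def)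
  ultimately have "r = 0"
    using dvd_imp_degree_le[of "map_poly \<iota> p" "map_poly \<iota> r"] map_emb_eq_iff[of r 0]
    by (auto simp: degree_map_emb)
  then show ?thesis
    by (simp add: r_def mod_eq_0_iff_dvd)
qed

lemma cubic_simple_roots:
  fixes D :: "'a::alg_closed_field poly"
  assumes "degree D = 3" and simple: "\<And>u. poly D u = 0 \<Longrightarrow> poly (pderiv D) u \<noteq> 0"
  obtains u v w where "poly D u = 0" "poly D v = 0" "poly D w = 0" "distinct [u, v, w]"
proof -
  have "D \<noteq> 0"
    using assms(1) by auto
  obtain S where S: "size S = degree D" "D = smult (lead_coeff D) (\<Prod>x\<in>#S. [:- x, 1:])"
    using alg_closed_imp_factorization[OF \<open>D \<noteq> 0\<close>] by blast
  then have "size S = Suc (Suc (Suc 0))"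
    using assms(1) by simp
  then obtain u v w where S_eq: "S = {#u, v, w#}"
    by (auto simp: size_eq_Suc_iff)
  define k where "k = lead_coeff D"
  have D: "D = smult k ([:- u, 1:] * [:- v, 1:] * [:- w, 1:])"
    using S(2) unfolding S_eq k_def[symmetric]
    by (simp add: mult.assoc del: mult_pCons_left mult_pCons_right)
  have roots: "poly D u = 0" "poly D v = 0" "poly D w = 0"
    by (simp_all add: D del: mult_pCons_left mult_pCons_right)
  moreover have "distinct [u, v, w]"
    using simple[OF roots(1)] simple[OF roots(2)] simple[OF roots(3)]
    by (auto simp: D pderiv_smult pderiv_mult pderiv_pCons simp del: mult_pCons_left mult_pCons_right)
  ultimately show thesis
    by (rule that)
qed

section \<open>Combining the arithmetic and geometric conditions\<close>

theorem theorem1p5: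
  shows "\<not> (\<exists>P Q :: rat poly.
    Polynomial.lead_coeff P = 1 \<and> Polynomial.degree P = 4 \<and>
    Q \<noteq> 0 \<and> Polynomial.degree Q \<le> 3 \<and>
    has_alternating_galois_group 4 (poly_line P Q) \<and>
    has_alternating_galois_group 4 (poly_line (map_poly to_ac P) (map_poly to_ac Q)))"
proof (intro notI, elim exE conjE)
  fix P Q :: "rat poly"
  assume P: "lead_coeff P = 1" "degree P = 4" and Q: "Q \<noteq> 0" "degree Q \<le> 3"
    and alt: "has_alternating_galois_group 4 (poly_line P Q)"
    and geom: "has_alternating_galois_group 4 (poly_line (map_poly to_ac P) (map_poly to_ac Q))"
  interpret e: field_emb "to_ac :: rat \<Rightarrow> _"
    by (rule field_emb_to_ac)
  let ?m = "map_poly (to_ac :: rat \<Rightarrow> _)"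
  obtain a b where ab: "a * P + b * Q = 1"
    using bezout_if_no_common_root alternating_line_no_common_root[OF geom] by metis
  obtain d where d: "4 * quartic_I (pencil (coeff (- Q)) (coeff (- P))) ^ 3
      - quartic_J (pencil (coeff (- Q)) (coeff (- P))) ^ 2 = 27 * d ^ 2" "d \<noteq> 0"
    using alternating_line_discriminant[OF alt P Q(2)] by metis
  obtain t where t: "poly d t \<noteq> 0"
    using d(2) poly_all_0_iff_0[of d] by blast
  define A where "A = P - smult t Q"
  obtain D where D: "27 * D ^ 2 = 4 * quartic_I (pencil (coeff A) (coeff Q)) ^ 3
      - quartic_J (pencil (coeff A) (coeff Q)) ^ 2" "degree D = 3"
    using unramified_pencil[OF d(1) t] unfolding A_def by metis
  have bezout: "a * A + (smult t a + b) * Q = 1"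
    using ab by (simp add: A_def algebra_simps)
  have "degree (smult t Q) < degree P"
    using P(2) Q(2) by (intro le_less_trans[OF degree_smult_le]) simp
  then have degree_A: "degree A = 4"
    unfolding A_def diff_conv_add_uminus by (subst degree_add_eq_left) (simp_all add: P(2))
  interpret quartic_pencil "?m A" "?m Q" "?m D"
    using quartic_pencil_map[OF e.field_emb_axioms degree_A Q(2) bezout D(1)] .
  define K where "K = quartic_I (pencil (coeff A) (coeff Q))"
  have I_eq: "I = ?m K"
    unfolding e.map_emb_pencil e.map_emb_quartic_I K_def ..
  \<comment> \<open>The members are rewritten in terms of the original line, to which the geometric
    group refers.\<close>
  have F_eq: "F u = smult u (?m P) - smult (u * to_ac t + 1) (?m Q)" for u
    by (simp add: A_def e.map_emb_diff e.map_emb_smult smult_diff_right smult_add_left)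
  \<comment> \<open>For two squares in the pencil, the determinant condition of
    \<open>alternating_line_two_squares\<close> reduces to \<open>u = v\<close>.\<close>
  have one_square: "u = v" if "poly (?m D) u = 0" "poly I u \<noteq> 0" "poly (?m D) v = 0" "poly I v \<noteq> 0" for u v
  proof -
    note squares = at_root(2)[OF that(1,2)] at_root(2)[OF that(3,4)]
    obtain q1 q2 where q: "degree q1 \<le> 2" "F u = q1 ^ 2" "degree q2 \<le> 2" "F v = q2 ^ 2"
      using squares by blast
    have "u * (v * to_ac t + 1) = (u * to_ac t + 1) * v"
    proof (rule alternating_line_two_squares[OF geom _ _ _ _ q(1,3)])
      show "?m a * ?m P + ?m b * ?m Q = 1"
        by (simp add: ab e.map_emb_one flip: e.map_emb_add e.map_emb_mult)
      show "smult u (?m P) - smult (u * to_ac t + 1) (?m Q) = q1 ^ 2"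
        "smult v (?m P) - smult (v * to_ac t + 1) (?m Q) = q2 ^ 2"
        using q(2,4) unfolding F_eq .
      show "?m Q \<noteq> 0"
        using Q(1) e.map_emb_eq_iff[of Q 0] by simp
    qed (use P Q in \<open>simp_all add: e.degree_map_emb\<close>)
    then show ?thesis
      by (simp add: algebra_simps)
  qed
  obtain w1 w2 w3 where w: "poly (?m D) w1 = 0" "poly (?m D) w2 = 0" "poly (?m D) w3 = 0" "distinct [w1, w2, w3]"
    using cubic_simple_roots[of "?m D"] at_root(1) D(2) by (auto simp: e.degree_map_emb)
  \<comment> \<open>At most one of the three distinct roots of D can have nonzero I.\<close>
  have "\<exists>u v. u \<noteq> v \<and> poly (?m D) u = 0 \<and> poly (?m D) v = 0 \<and> poly I u = 0 \<and> poly I v = 0"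
    using one_square[OF w(1) _ w(2)] one_square[OF w(1) _ w(3)] one_square[OF w(2) _ w(3)] w by auto
  then obtain u v where uv: "u \<noteq> v" "poly (?m D) u = 0" "poly (?m D) v = 0" "poly (?m K) u = 0" "poly (?m K) v = 0"
    unfolding I_eq by blast
  \<comment> \<open>Otherwise \<open>27 D^2 + J^2 = 0\<close> over the rationals, where a sum of
    squares vanishes only if each term does.\<close>
  have "K \<noteq> 0"
  proof
    assume "K = 0"
    then have eq: "27 * D ^ 2 + quartic_J (pencil (coeff A) (coeff Q)) ^ 2 = 0"
      using D(1) by (simp add: K_def)
    have "poly D x = 0" for x
      using arg_cong[OF eq, of "\<lambda>p. poly p x"] by (simp add: add_nonneg_eq_0_iff)
    then have "D = 0"
      using poly_all_0_iff_0[of D] by blast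
    then show False
      using D(2) by simp
  qed
  define g where "g = [:- u, 1:] * [:- v, 1:]"
  have deg_g: "degree g = 2" "lead_coeff g = 1"
    by (simp_all add: g_def)
  obtain h where h: "?m K = g * h"
    using poly_with_two_roots[OF uv(4,5,1)] unfolding g_def by (elim dvdE)
  have "h \<noteq> 0" "g \<noteq> 0"
    using h \<open>K \<noteq> 0\<close> e.map_emb_eq_iff[of K 0] by auto
  then have "degree K = 2 + degree h"
    using arg_cong[OF h, of degree] by (simp add: degree_mult_eq deg_g e.degree_map_emb)
  moreover have "degree K \<le> 2"
    unfolding K_def by (rule degree_quartic_I_pencil)
  ultimately have deg: "degree K = 2" "degree h = 0"
    by simp_all
  then obtain c where c: "h = [:c:]" "c \<noteq> 0"
    using \<open>h \<noteq> 0\<close> by (metis degree_eq_zeroE pCons_0_0)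
  have K_eq: "?m K = [:c * (u * v), - c * (u + v), c:]"
    unfolding h g_def c by (simp add: algebra_simps)
  have "g dvd ?m D"
    using poly_with_two_roots[OF uv(2,3,1)] by (simp add: g_def)
  then have "?m K dvd ?m D"
    using c unfolding h by (simp add: smult_dvd_iff)
  then have "K dvd D"
    using \<open>K \<noteq> 0\<close> by (rule e.map_emb_dvdD)
  \<comment> \<open>Distinctness of \<open>u\<close> and \<open>v\<close> is expressed by the
    discriminant of K, a rational number, so that it can be used over the complex numbers.\<close>
  have "coeff (?m K) 1 ^ 2 - 4 * coeff (?m K) 2 * coeff (?m K) 0 = (c * (u - v)) ^ 2"
    unfolding K_eq by (simp add: numeral_2_eq_2 algebra_simps power2_eq_square)
  then have "to_ac (coeff K 1 ^ 2 - 4 * coeff K 2 * coeff K 0) = (c * (u - v)) ^ 2"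
    by (simp add: e.coeff_map_emb)
  also have "\<dots> \<noteq> 0"
    using c(2) uv(1) by simp
  finally have "coeff K 1 ^ 2 \<noteq> 4 * coeff K 2 * coeff K 0"
    by (auto simp del: to_ac_diff)
  then show False
    using no_conjugate_triple_roots[OF degree_A Q(2) bezout] D \<open>K dvd D\<close> deg(1) unfolding K_def by blast
qed

end
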